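(* Let $K$ be an algebraically closed field and let $A=KQ/I$ be a local finite dimensional graded $K$-algebra such that $\Sigma_0(A)=\emptyset$. Suppose $Q$ has loops $\alpha_1,\alpha_2,\ldots,\alpha_n$ (these being all the arrows of $Q$, which has one vertex). If none of the $\alpha_i\|\alpha_j$ with $i\neq j$, $1\leq i,j\leq n$, is in $\Sigma_1(A)$, then $\mathrm{HH}^1(A)$ is solvable.
   Context: $\mathrm{HH}^1(A)=\mathrm{Der}_K(A)/\mathrm{Inn}(A)$, with Lie bracket induced by the commutator of derivations. $Q$ is a finite quiver with vertex set $Q_0$ and arrow set $Q_1$, and $I$ is an admissible ideal of $KQ$; $A$ local means $Q$ has a single vertex. "Graded" means that $I$ is generated by relations that are homogeneous with respect to path length, so $A$ is graded with arrows in degree one. Fix a $K$-basis $\mathcal{B}$ of $A$ consisting of the classes of paths that cannot be reduced modulo $I$ (the paths that are not leading terms of elements of $I$ for a fixed order on paths), and let $\mathcal{B}_i$ be the set of elements of $\mathcal{B}$ that are paths of length $i$; so $\mathcal{B}_0=Q_0$ and $\mathcal{B}_1=Q_1$. For $\alpha\in Q_1$ and $\beta\in\mathcal{B}$ parallel (same source and same target), $\alpha\|\beta$ denotes the linear map sending the arrow $\alpha$ to $\beta$ and all other arrows to $0$; $Q_1\|\mathcal{B}_i$ is the set of such $\alpha\|\beta$ with $\beta\in\mathcal{B}_i$. A linear combination $x=\sum_j\lambda_j\,\alpha_j\|\beta_j$ of pairwise distinct such elements lies in $\ker(\delta^1)$ if and only if there is a $K$-linear derivation $d$ of $A$ with $d(e)=0$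 for all $e\in Q_0$ and $d(\alpha)=\sum_{j:\alpha_j=\alpha}\lambda_j\beta_j$ for every arrow $\alpha$. For $i\geq 0$, $\Sigma_i(A)$ is the set of all $\alpha\|\beta\in Q_1\|\mathcal{B}_i$ that occur with nonzero coefficient in some element of $\ker(\delta^1)$. *)

theory Defs
  imports
    "Graph_Theory.Arc_Walk"
    "HOL-Algebra.QuotRing"
    "HOL-Algebra.Module"
    "HOL-Computational_Algebra.Polynomial"
begin

section \<open>Algebras over a field type\<close>

text \<open>
  The ground field is a type \<open>'k\<close> of class \<^class>\<open>field\<close>. A (not necessarily associative)
  \<open>'k\<close>-algebra is a record of type \<open>('k, 'b) module\<close>; in the case of a Lie algebra the
  multiplication of the record is the Lie bracket, and the field \<open>one\<close> is never looked at.
\<close>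

inductive_set lin_span :: "('k::field, 'b) module \<Rightarrow> 'b set \<Rightarrow> 'b set"
  for M :: "('k, 'b) module" and S :: "'b set" where
  span_zero: "\<zero>\<^bsub>M\<^esub> \<in> lin_span M S"
| span_base: "x \<in> S \<Longrightarrow> x \<in> lin_span M S"
| span_add: "x \<in> lin_span M S \<Longrightarrow> y \<in> lin_span M S \<Longrightarrow> x \<oplus>\<^bsub>M\<^esub> y \<in> lin_span M S"
| span_smult: "x \<in> lin_span M S \<Longrightarrow> c \<odot>\<^bsub>M\<^esub> x \<in> lin_span M S"

definition fin_dim :: "('k::field, 'b) module \<Rightarrow> bool" where
  "fin_dim M \<longleftrightarrow> (\<exists>S. finite S \<and> S \<subseteq> carrier M \<and> lin_span M S = carrier M)"

text \<open>
  The quotient by an ideal \<open>N\<close>: this is \<^const>\<open>FactRing\<close> together with the induced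
  scalar multiplication. Used for associative algebras and for Lie algebras (where
  \<^const>\<open>rcoset_mult\<close> is the induced bracket).
\<close>

definition quot_alg :: "('k::field, 'b) module \<Rightarrow> 'b set \<Rightarrow> ('k, 'b set) module" where
  "quot_alg M N =
    \<lparr>carrier = a_rcosets\<^bsub>M\<^esub> N, monoid.mult = rcoset_mult M N, one = N +>\<^bsub>M\<^esub> \<one>\<^bsub>M\<^esub>,
     zero = N, add = set_add M,
     module.smult = (\<lambda>c X. \<Union>x\<in>X. N +>\<^bsub>M\<^esub> (c \<odot>\<^bsub>M\<^esub> x))\<rparr>"

fun derived_series :: "('k::field, 'b) module \<Rightarrow> nat \<Rightarrow> 'b set" where
  "derived_series L 0 = carrier L"
| "derived_series L (Suc n) =
     lin_span L {x \<otimes>\<^bsub>L\<^esub> y |x y. x \<in> derived_series L n \<and> y \<in> derived_series L n}"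

definition lie_solvable :: "('k::field, 'b) module \<Rightarrow> bool" where
  "lie_solvable L \<longleftrightarrow> (\<exists>n. derived_series L n = {\<zero>\<^bsub>L\<^esub>})"


section \<open>Derivations and the first Hochschild cohomology\<close>

definition Der :: "('k::field, 'b) module \<Rightarrow> ('b \<Rightarrow> 'b) set" where
  "Der A = {d \<in> carrier A \<rightarrow>\<^sub>E carrier A.
     (\<forall>x\<in>carrier A. \<forall>y\<in>carrier A. d (x \<oplus>\<^bsub>A\<^esub> y) = d x \<oplus>\<^bsub>A\<^esub> d y) \<and>
     (\<forall>c. \<forall>x\<in>carrier A. d (c \<odot>\<^bsub>A\<^esub> x) = c \<odot>\<^bsub>A\<^esub> d x) \<and>
     (\<forall>x\<in>carrier A. \<forall>y\<in>carrier A.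
        d (x \<otimes>\<^bsub>A\<^esub> y) = (d x \<otimes>\<^bsub>A\<^esub> y) \<oplus>\<^bsub>A\<^esub> (x \<otimes>\<^bsub>A\<^esub> d y))}"

definition Inn :: "('k::field, 'b) module \<Rightarrow> ('b \<Rightarrow> 'b) set" where
  "Inn A = {\<lambda>x\<in>carrier A. (a \<otimes>\<^bsub>A\<^esub> x) \<ominus>\<^bsub>A\<^esub> (x \<otimes>\<^bsub>A\<^esub> a) |a. a \<in> carrier A}"

definition Der_lie :: "('k::field, 'b) module \<Rightarrow> ('k, 'b \<Rightarrow> 'b) module" where
  "Der_lie A =
    \<lparr>carrier = Der A,
     monoid.mult = (\<lambda>d d'. \<lambda>x\<in>carrier A. d (d' x) \<ominus>\<^bsub>A\<^esub> d' (d x)),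
     one = undefined,
     zero = (\<lambda>x\<in>carrier A. \<zero>\<^bsub>A\<^esub>),
     add = (\<lambda>d d'. \<lambda>x\<in>carrier A. d x \<oplus>\<^bsub>A\<^esub> d' x),
     module.smult = (\<lambda>c d. \<lambda>x\<in>carrier A. c \<odot>\<^bsub>A\<^esub> d x)\<rparr>"

definition HH1 :: "('k::field, 'b) module \<Rightarrow> ('k, ('b \<Rightarrow> 'b) set) module" where
  "HH1 A = quot_alg (Der_lie A) (Inn A)"


section \<open>Path algebras and their quotients\<close>

text \<open>
  A finite quiver is a \<^locale>\<open>fin_digraph\<close> (which may have loops and multiple arrows), and a path
  is given by its start vertex and the list of its arrows in the order in which they are traversed.
\<close>

type_synonym ('v, 'a) path = "'v \<times> 'a list"

definition is_path :: "('v, 'a) pre_digraph \<Rightarrow> 'v \<Rightarrow> ('v, 'a) path \<Rightarrow> 'v \<Rightarrow> bool" where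
  "is_path Q u p v \<longleftrightarrow> fst p = u \<and> pre_digraph.awalk Q u (snd p) v"

definition paths :: "('v, 'a) pre_digraph \<Rightarrow> ('v, 'a) path set" where
  "paths Q = {p. \<exists>u v. is_path Q u p v}"

abbreviation path_len :: "('v, 'a) path \<Rightarrow> nat" where
  "path_len p \<equiv> length (snd p)"

definition arrow_path :: "('v, 'a) pre_digraph \<Rightarrow> 'a \<Rightarrow> ('v, 'a) path" where
  "arrow_path Q a = (tail Q a, [a])"

text \<open>
  Elements of \<open>KQ\<close> are the finitely supported coefficient functions on paths. The product is the
  convolution over all ways of cutting a path into an initial and a final piece; the final piece
  starts where the initial one ends.
\<close>

definition path_algebra :: "('v, 'a) pre_digraph \<Rightarrow> ('k::field, ('v, 'a) path \<Rightarrow> 'k) module" where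
  "path_algebra Q =
    \<lparr>carrier = {f. finite {p. f p \<noteq> 0} \<and> {p. f p \<noteq> 0} \<subseteq> paths Q},
     monoid.mult = (\<lambda>f g (u, w). \<Sum>i\<le>length w.
               f (u, take i w) * g (pre_digraph.awlast Q u (take i w), drop i w)),
     one = (\<lambda>(u, w). if u \<in> verts Q \<and> w = [] then 1 else 0),
     zero = (\<lambda>p. 0),
     add = (\<lambda>f g p. f p + g p),
     module.smult = (\<lambda>c f p. c * f p)\<rparr>"

definition single :: "'p \<Rightarrow> 'p \<Rightarrow> 'k::field" where
  "single p = (\<lambda>q. if q = p then 1 else 0)"

text \<open>
  The \<open>m\<close>-th power of the arrow ideal is the span of the paths of length at least \<open>m\<close>.
\<close>

definition arrow_ideal_pow ::
    "('v, 'a) pre_digraph \<Rightarrow> nat \<Rightarrow> (('v, 'a) path \<Rightarrow> 'k::field) set" where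
  "arrow_ideal_pow Q m = lin_span (path_algebra Q) {single p |p. p \<in> paths Q \<and> m \<le> path_len p}"

definition admissible_ideal ::
    "('v, 'a) pre_digraph \<Rightarrow> (('v, 'a) path \<Rightarrow> 'k::field) set \<Rightarrow> bool" where
  "admissible_ideal Q I \<longleftrightarrow> ideal I (path_algebra Q) \<and>
     I \<subseteq> arrow_ideal_pow Q 2 \<and> (\<exists>m\<ge>2. arrow_ideal_pow Q m \<subseteq> I)"

definition homogeneous_relation ::
    "('v, 'a) pre_digraph \<Rightarrow> (('v, 'a) path \<Rightarrow> 'k::field) \<Rightarrow> bool" where
  "homogeneous_relation Q r \<longleftrightarrow> r \<in> carrier (path_algebra Q) \<and>
     (\<exists>m\<ge>2. \<exists>u v. \<forall>p. r p \<noteq> 0 \<longrightarrow> is_path Q u p v \<and> path_len p = m)"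

definition graded_ideal ::
    "('v, 'a) pre_digraph \<Rightarrow> (('v, 'a) path \<Rightarrow> 'k::field) set \<Rightarrow> bool" where
  "graded_ideal Q I \<longleftrightarrow>
     (\<exists>S. (\<forall>r\<in>S. homogeneous_relation Q r) \<and> I = Idl\<^bsub>path_algebra Q\<^esub> S)"

definition quiver_algebra ::
    "('v, 'a) pre_digraph \<Rightarrow> (('v, 'a) path \<Rightarrow> 'k::field) set
      \<Rightarrow> ('k, (('v, 'a) path \<Rightarrow> 'k) set) module" where
  "quiver_algebra Q I = quot_alg (path_algebra Q) I"

definition cls ::
    "('v, 'a) pre_digraph \<Rightarrow> (('v, 'a) path \<Rightarrow> 'k::field) set \<Rightarrow> ('v, 'a) path
      \<Rightarrow> (('v, 'a) path \<Rightarrow> 'k) set" where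
  "cls Q I p = I +>\<^bsub>path_algebra Q\<^esub> single p"


section \<open>The kernel of \<open>\<delta>\<^sup>1\<close> and the sets \<open>\<Sigma>\<^sub>i\<close>\<close>

text \<open>
  \<open>(q, p) \<in> ord\<close> means that \<open>q\<close> is at most \<open>p\<close>. Any linear order on the paths will do: since an
  admissible ideal contains all long paths, the irreducible paths form a basis of the quotient
  even if the order is neither a well-order nor compatible with concatenation.
\<close>

definition is_leading_path ::
    "('v, 'a) path rel \<Rightarrow> (('v, 'a) path \<Rightarrow> 'k::field) \<Rightarrow> ('v, 'a) path \<Rightarrow> bool" where
  "is_leading_path ord f p \<longleftrightarrow> f p \<noteq> 0 \<and> (\<forall>q. f q \<noteq> 0 \<longrightarrow> (q, p) \<in> ord)"

text \<open>
  The classes of distinct paths in \<open>basis_paths\<close> are linearly independent modulo \<open>I\<close>; so basis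
  elements are represented by their paths, and the map \<open>\<alpha>\<parallel>\<beta>\<close> by the pair \<open>(\<alpha>, \<beta>)\<close>.
\<close>

definition basis_paths ::
    "('v, 'a) pre_digraph \<Rightarrow> (('v, 'a) path \<Rightarrow> 'k::field) set \<Rightarrow> ('v, 'a) path rel
      \<Rightarrow> ('v, 'a) path set" where
  "basis_paths Q I ord = paths Q - {p. \<exists>f\<in>I. is_leading_path ord f p}"

definition parallel_pairs ::
    "('v, 'a) pre_digraph \<Rightarrow> (('v, 'a) path \<Rightarrow> 'k::field) set \<Rightarrow> ('v, 'a) path rel
      \<Rightarrow> ('a \<times> ('v, 'a) path) set" where
  "parallel_pairs Q I ord =
     {(a, b). a \<in> arcs Q \<and> b \<in> basis_paths Q I ord \<and> is_path Q (tail Q a) b (head Q a)}"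

text \<open>A linear combination of parallel pairs is represented by its coefficient function \<open>x\<close>.\<close>

definition ker_delta1 ::
    "('v, 'a) pre_digraph \<Rightarrow> (('v, 'a) path \<Rightarrow> 'k::field) set \<Rightarrow> ('v, 'a) path rel
      \<Rightarrow> ('a \<times> ('v, 'a) path \<Rightarrow> 'k) set" where
  "ker_delta1 Q I ord =
     {x. finite {ab. x ab \<noteq> 0} \<and> {ab. x ab \<noteq> 0} \<subseteq> parallel_pairs Q I ord \<and>
       (\<exists>d \<in> Der (quiver_algebra Q I).
          (\<forall>e\<in>verts Q. d (cls Q I (e, [])) = \<zero>\<^bsub>quiver_algebra Q I\<^esub>) \<and>
          (\<forall>a\<in>arcs Q. d (cls Q I (arrow_path Q a)) =
             (\<Oplus>\<^bsub>quiver_algebra Q I\<^esub>b\<in>{b. x (a, b) \<noteq> 0}.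
                x (a, b) \<odot>\<^bsub>quiver_algebra Q I\<^esub> cls Q I b)))}"

definition Sigma_set ::
    "('v, 'a) pre_digraph \<Rightarrow> (('v, 'a) path \<Rightarrow> 'k::field) set \<Rightarrow> ('v, 'a) path rel \<Rightarrow> nat
      \<Rightarrow> ('a \<times> ('v, 'a) path) set" where
  "Sigma_set Q I ord i =
     {(a, b) \<in> parallel_pairs Q I ord. path_len b = i \<and>
        (\<exists>x \<in> ker_delta1 Q I ord. x (a, b) \<noteq> 0)}"

end

theory Submission
  imports Defs
begin

text \<open>
  Let \<open>J\<close> be the ideal of \<open>A\<close> generated by the arrows. The hypotheses on \<open>\<Sigma>\<^sub>0(A)\<close> and
  \<open>\<Sigma>\<^sub>1(A)\<close> say that every derivation maps each arrow \<open>\<alpha>\<close> to a multiple of \<open>\<alpha>\<close> modulo \<open>J\<^sup>2\<close>.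
  So derivations act on \<open>J/J\<^sup>2\<close> by diagonal matrices, and a commutator of two of them maps
  the arrows into \<open>J\<^sup>2\<close>. By the Leibniz rule derivations then preserve the powers of \<open>J\<close>,
  and commutators raise the exponent by one. Since \<open>J\<close> is nilpotent, the Lie algebra of
  derivations is solvable, and so is its quotient by the inner ones.
\<close>

section \<open>Derivations of an algebra\<close>

text \<open>The sets \<Sigma>_i only see derivations that kill the trivial paths. In the local case
  the trivial path is the identity of A, so every derivation qualifies. Its values on the arrows,
  written in irreducible paths, form an element of \<open>ker_delta1\<close>; every coefficient that
  occurs therefore puts a pair into some \<Sigma>_i, and this is how the hypotheses constrain all
  derivations at once. Let D_k be the space of derivations that raise the exponent of J by at least
  k. Then [D_k, D_l] lies in D_(k+l), which makes the series descend as soon as k and l are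
  positive. For k = l = 0 nothing is gained, and this one step is what the diagonal action pays for:
  the diagonal coefficients are scalars and commute, so [D_0, D_0] lies in D_1. The chain consists
  of derivations of A, not of classes in HH^1: the derived series of the quotient stays inside the
  image of such a chain. Inner derivations matter only for the operations on cosets to be well
  defined, that is, for \<open>Inn A\<close> to be a Lie ideal.\<close>

locale k_algebra = ring A for A :: "('k::field, 'b) module" (structure) +
  assumes smult_closed [simp, intro]: "x \<in> carrier A \<Longrightarrow> c \<odot> x \<in> carrier A"
    and smult_l_distr: "x \<in> carrier A \<Longrightarrow> (a + b) \<odot> x = a \<odot> x \<oplus> b \<odot> x"
    and smult_r_distr: "x \<in> carrier A \<Longrightarrow> y \<in> carrier A \<Longrightarrow> c \<odot> (x \<oplus> y) = c \<odot> x \<oplus> c \<odot> y"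
    and smult_assoc: "x \<in> carrier A \<Longrightarrow> a \<odot> (b \<odot> x) = (a * b) \<odot> x"
    and smult_one: "x \<in> carrier A \<Longrightarrow> 1 \<odot> x = x"
    and smult_mult_l: "x \<in> carrier A \<Longrightarrow> y \<in> carrier A \<Longrightarrow> (c \<odot> x) \<otimes> y = c \<odot> (x \<otimes> y)"
    and smult_mult_r: "x \<in> carrier A \<Longrightarrow> y \<in> carrier A \<Longrightarrow> x \<otimes> (c \<odot> y) = c \<odot> (x \<otimes> y)"
begin

lemma smult_l_null: "x \<in> carrier A \<Longrightarrow> 0 \<odot> x = \<zero>"
  using smult_l_distr[of x 0 0] by simp

lemma smult_r_null: "c \<odot> \<zero> = \<zero>"
  using smult_r_distr[of \<zero> \<zero> c] by simp

lemma smult_minus: "x \<in> carrier A \<Longrightarrow> c \<odot> (\<ominus> x) = \<ominus> (c \<odot> x)"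
  using smult_r_distr[of "\<ominus> x" x c, symmetric]
  by (intro minus_equality[symmetric]) (simp_all add: l_neg smult_r_null)

lemma smult_neg_one: "x \<in> carrier A \<Longrightarrow> (-1) \<odot> x = \<ominus> x"
  using smult_l_distr[of x "-1" 1]
  by (intro minus_equality[symmetric]) (simp_all add: smult_one smult_l_null)

lemma smult_diff:
  "x \<in> carrier A \<Longrightarrow> y \<in> carrier A \<Longrightarrow> c \<odot> (x \<ominus> y) = c \<odot> x \<ominus> c \<odot> y"
  by (simp add: minus_eq smult_r_distr smult_minus)

lemma DerI:
  assumes "d \<in> carrier A \<rightarrow>\<^sub>E carrier A"
    and "\<And>x y. x \<in> carrier A \<Longrightarrow> y \<in> carrier A \<Longrightarrow> d (x \<oplus> y) = d x \<oplus> d y"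
    and "\<And>c x. x \<in> carrier A \<Longrightarrow> d (c \<odot> x) = c \<odot> d x"
    and "\<And>x y. x \<in> carrier A \<Longrightarrow> y \<in> carrier A \<Longrightarrow> d (x \<otimes> y) = d x \<otimes> y \<oplus> x \<otimes> d y"
  shows "d \<in> Der A"
  using assms by (simp add: Der_def)

lemma
  assumes "d \<in> Der A"
  shows Der_closed [simp]: "x \<in> carrier A \<Longrightarrow> d x \<in> carrier A"
    and Der_extensional: "d \<in> extensional (carrier A)"
    and Der_add: "x \<in> carrier A \<Longrightarrow> y \<in> carrier A \<Longrightarrow> d (x \<oplus> y) = d x \<oplus> d y"
    and Der_smult: "x \<in> carrier A \<Longrightarrow> d (c \<odot> x) = c \<odot> d x"
    and Der_mult: "x \<in> carrier A \<Longrightarrow> y \<in> carrier A \<Longrightarrow> d (x \<otimes> y) = d x \<otimes> y \<oplus> x \<otimes> d y"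
  using assms unfolding Der_def by (auto simp: PiE_def)

lemma Der_zero: "d \<in> Der A \<Longrightarrow> d \<zero> = \<zero>"
  using Der_add[of d \<zero> \<zero>] by simp

lemma Der_minus: "d \<in> Der A \<Longrightarrow> x \<in> carrier A \<Longrightarrow> d (\<ominus> x) = \<ominus> d x"
  using Der_add[of d "\<ominus> x" x, symmetric]
  by (intro minus_equality[symmetric]) (simp_all add: l_neg Der_zero)

lemma Der_diff:
  "d \<in> Der A \<Longrightarrow> x \<in> carrier A \<Longrightarrow> y \<in> carrier A \<Longrightarrow> d (x \<ominus> y) = d x \<ominus> d y"
  by (simp add: minus_eq Der_add Der_minus)

text \<open>From 1 = 1 * 1 one gets d(1) = d(1) + d(1). With a single vertex the trivial path is the
  identity, so this discharges the condition d(e) = 0 in \<open>ker_delta1\<close>.\<close>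

lemma Der_one: "d \<in> Der A \<Longrightarrow> d \<one> = \<zero>"
  using Der_mult[of d \<one> \<one>] by simp

lemma Der_eqI:
  assumes "d \<in> Der A" "d' \<in> Der A" "\<And>x. x \<in> carrier A \<Longrightarrow> d x = d' x"
  shows "d = d'"
  using assms by (intro extensionalityI[OF Der_extensional Der_extensional])

section \<open>Operations on the space of derivations\<close>

abbreviation L where "L \<equiv> Der_lie A"

lemma Der_lie_sel:
  "carrier L = Der A" "\<zero>\<^bsub>L\<^esub> = (\<lambda>x\<in>carrier A. \<zero>)"
  by (simp_all add: Der_lie_def)

lemma
  assumes "x \<in> carrier A"
  shows Der_lie_add: "(d \<oplus>\<^bsub>L\<^esub> d') x = d x \<oplus> d' x"
    and Der_lie_smult: "(c \<odot>\<^bsub>L\<^esub> d) x = c \<odot> d x"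
    and Der_lie_mult: "(d \<otimes>\<^bsub>L\<^esub> d') x = d (d' x) \<ominus> d' (d x)"
    and Der_lie_zero: "\<zero>\<^bsub>L\<^esub> x = \<zero>"
  using assms by (simp_all add: Der_lie_def)

lemma zero_mem_Der: "\<zero>\<^bsub>L\<^esub> \<in> Der A"
  by (rule DerI) (auto simp: Der_lie_def smult_r_null)

lemma add_mem_Der:
  assumes "d \<in> Der A" "d' \<in> Der A" shows "d \<oplus>\<^bsub>L\<^esub> d' \<in> Der A"
proof (rule DerI)
  show "d \<oplus>\<^bsub>L\<^esub> d' \<in> carrier A \<rightarrow>\<^sub>E carrier A"
    using assms by (auto simp: Der_lie_def)
  fix x y c assume x: "x \<in> carrier A"
  show "(d \<oplus>\<^bsub>L\<^esub> d') (c \<odot> x) = c \<odot> (d \<oplus>\<^bsub>L\<^esub> d') x"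
    using x assms by (simp add: Der_lie_add Der_smult smult_r_distr)
  assume y: "y \<in> carrier A"
  show "(d \<oplus>\<^bsub>L\<^esub> d') (x \<oplus> y) = (d \<oplus>\<^bsub>L\<^esub> d') x \<oplus> (d \<oplus>\<^bsub>L\<^esub> d') y"
    using x y assms by (simp add: Der_lie_add Der_add a_ac)
  show "(d \<oplus>\<^bsub>L\<^esub> d') (x \<otimes> y) = (d \<oplus>\<^bsub>L\<^esub> d') x \<otimes> y \<oplus> x \<otimes> (d \<oplus>\<^bsub>L\<^esub> d') y"
    using x y assms by (simp add: Der_lie_add Der_mult l_distr r_distr a_ac)
qed

lemma smult_mem_Der:
  assumes "d \<in> Der A" shows "c \<odot>\<^bsub>L\<^esub> d \<in> Der A"
proof (rule DerI)
  show "c \<odot>\<^bsub>L\<^esub> d \<in> carrier A \<rightarrow>\<^sub>E carrier A"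
    using assms by (auto simp: Der_lie_def)
  fix x y c' assume x: "x \<in> carrier A"
  show "(c \<odot>\<^bsub>L\<^esub> d) (c' \<odot> x) = c' \<odot> (c \<odot>\<^bsub>L\<^esub> d) x"
    using x assms by (simp add: Der_lie_smult Der_smult smult_assoc mult.commute)
  assume y: "y \<in> carrier A"
  show "(c \<odot>\<^bsub>L\<^esub> d) (x \<oplus> y) = (c \<odot>\<^bsub>L\<^esub> d) x \<oplus> (c \<odot>\<^bsub>L\<^esub> d) y"
    using x y assms by (simp add: Der_lie_smult Der_add smult_r_distr)
  show "(c \<odot>\<^bsub>L\<^esub> d) (x \<otimes> y) = (c \<odot>\<^bsub>L\<^esub> d) x \<otimes> y \<oplus> x \<otimes> (c \<odot>\<^bsub>L\<^esub> d) y"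
    using x y assms by (simp add: Der_lie_smult Der_mult smult_r_distr smult_mult_l smult_mult_r)
qed

lemma mult_mem_Der:
  assumes "d \<in> Der A" "d' \<in> Der A" shows "d \<otimes>\<^bsub>L\<^esub> d' \<in> Der A"
proof (rule DerI)
  show "d \<otimes>\<^bsub>L\<^esub> d' \<in> carrier A \<rightarrow>\<^sub>E carrier A"
    using assms by (auto simp: Der_lie_def)
  fix x y c assume x: "x \<in> carrier A"
  show "(d \<otimes>\<^bsub>L\<^esub> d') (c \<odot> x) = c \<odot> (d \<otimes>\<^bsub>L\<^esub> d') x"
    using x assms by (simp add: Der_lie_mult Der_smult smult_diff)
  assume y: "y \<in> carrier A"
  note c = x y Der_closed[OF assms(1)] Der_closed[OF assms(2)]
  have "(d \<otimes>\<^bsub>L\<^esub> d') (x \<oplus> y) = (d (d' x) \<oplus> d (d' y)) \<ominus> (d' (d x) \<oplus> d' (d y))"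
    using c assms by (simp add: Der_lie_mult Der_add)
  also have "\<dots> = (d (d' x) \<ominus> d' (d x)) \<oplus> (d (d' y) \<ominus> d' (d y))"
    using c by algebra
  finally show "(d \<otimes>\<^bsub>L\<^esub> d') (x \<oplus> y) = (d \<otimes>\<^bsub>L\<^esub> d') x \<oplus> (d \<otimes>\<^bsub>L\<^esub> d') y"
    using x y by (simp add: Der_lie_mult)
  have "(d \<otimes>\<^bsub>L\<^esub> d') (x \<otimes> y)
    = (d (d' x) \<otimes> y \<oplus> d' x \<otimes> d y \<oplus> (d x \<otimes> d' y \<oplus> x \<otimes> d (d' y))) \<ominus>
      (d' (d x) \<otimes> y \<oplus> d x \<otimes> d' y \<oplus> (d' x \<otimes> d y \<oplus> x \<otimes> d' (d y)))"
    using c assms by (simp add: Der_lie_mult Der_add Der_mult)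
  \<comment> \<open>The mixed products d' x * d y and d x * d' y occur once with each sign and
    cancel; what survives is the Leibniz rule for the commutator.\<close>
  also have "\<dots> = (d (d' x) \<ominus> d' (d x)) \<otimes> y \<oplus> x \<otimes> (d (d' y) \<ominus> d' (d y))"
    using c by algebra
  finally show "(d \<otimes>\<^bsub>L\<^esub> d') (x \<otimes> y) = (d \<otimes>\<^bsub>L\<^esub> d') x \<otimes> y \<oplus> x \<otimes> (d \<otimes>\<^bsub>L\<^esub> d') y"
    using x y by (simp add: Der_lie_mult)
qed

lemma Der_lie_abelian_group: "abelian_group L"
proof (rule abelian_groupI)
  fix d assume d: "d \<in> carrier L"
  show "\<exists>d'\<in>carrier L. d' \<oplus>\<^bsub>L\<^esub> d = \<zero>\<^bsub>L\<^esub>"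
  proof
    show *: "(-1) \<odot>\<^bsub>L\<^esub> d \<in> carrier L"
      using d smult_mem_Der by (simp add: Der_lie_sel)
    show "(-1) \<odot>\<^bsub>L\<^esub> d \<oplus>\<^bsub>L\<^esub> d = \<zero>\<^bsub>L\<^esub>"
    proof (rule Der_eqI)
      fix x assume x: "x \<in> carrier A"
      then have "(-1) \<odot> d x \<oplus> d x = \<zero>"
        using smult_l_distr[of "d x" "-1" 1] d
        by (simp add: Der_lie_sel smult_one smult_l_null)
      then show "((-1) \<odot>\<^bsub>L\<^esub> d \<oplus>\<^bsub>L\<^esub> d) x = \<zero>\<^bsub>L\<^esub> x"
        using x by (simp add: Der_lie_add Der_lie_smult Der_lie_zero)
    qed (use * d in \<open>simp_all add: Der_lie_sel(1) add_mem_Der zero_mem_Der\<close>)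
  qed
qed (auto simp: Der_lie_sel(1) add_mem_Der zero_mem_Der Der_lie_add Der_lie_zero a_ac
    intro!: Der_eqI)

section \<open>Inner derivations form a Lie ideal\<close>

definition ad :: "'b \<Rightarrow> 'b \<Rightarrow> 'b" where
  "ad a = (\<lambda>x\<in>carrier A. a \<otimes> x \<ominus> x \<otimes> a)"

lemma Inn_eq: "Inn A = ad ` carrier A"
  by (auto simp: Inn_def ad_def)

lemma ad_mem_Der:
  assumes a: "a \<in> carrier A" shows "ad a \<in> Der A"
proof (rule DerI)
  show "ad a \<in> carrier A \<rightarrow>\<^sub>E carrier A"
    using assms by (auto simp: ad_def)
  fix x y c assume x: "x \<in> carrier A"
  show "ad a (c \<odot> x) = c \<odot> ad a x"
    using x a by (simp add: ad_def smult_diff smult_mult_l smult_mult_r)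
  assume y: "y \<in> carrier A"
  show "ad a (x \<oplus> y) = ad a x \<oplus> ad a y"
    using x y a by (simp add: ad_def) algebra
  show "ad a (x \<otimes> y) = ad a x \<otimes> y \<oplus> x \<otimes> ad a y"
    using x y a by (simp add: ad_def) algebra
qed

lemma ad_add: "a \<in> carrier A \<Longrightarrow> b \<in> carrier A \<Longrightarrow> ad a \<oplus>\<^bsub>L\<^esub> ad b = ad (a \<oplus> b)"
  by (rule Der_eqI)
    (simp_all add: add_mem_Der ad_mem_Der Der_lie_add, simp add: ad_def, algebra)

lemma ad_smult: "a \<in> carrier A \<Longrightarrow> c \<odot>\<^bsub>L\<^esub> ad a = ad (c \<odot> a)"
  by (rule Der_eqI)
    (simp_all add: smult_mem_Der ad_mem_Der Der_lie_smult,
      simp add: ad_def smult_diff smult_mult_l smult_mult_r)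

lemma ad_zero: "ad \<zero> = \<zero>\<^bsub>L\<^esub>"
  by (rule Der_eqI)
    (simp_all add: zero_mem_Der ad_mem_Der Der_lie_zero, simp add: ad_def minus_eq)

lemma bracket_add_left:
  assumes "d1 \<in> Der A" "d2 \<in> Der A" "d \<in> Der A"
  shows "(d1 \<oplus>\<^bsub>L\<^esub> d2) \<otimes>\<^bsub>L\<^esub> d = d1 \<otimes>\<^bsub>L\<^esub> d \<oplus>\<^bsub>L\<^esub> d2 \<otimes>\<^bsub>L\<^esub> d"
proof (rule Der_eqI)
  fix x assume x: "x \<in> carrier A"
  note c = x Der_closed[OF assms(1)] Der_closed[OF assms(2)] Der_closed[OF assms(3)]
  have "((d1 \<oplus>\<^bsub>L\<^esub> d2) \<otimes>\<^bsub>L\<^esub> d) x = d1 (d x) \<oplus> d2 (d x) \<ominus> (d (d1 x) \<oplus> d (d2 x))"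
    using c assms by (simp add: Der_lie_mult Der_lie_add Der_add)
  also have "\<dots> = (d1 (d x) \<ominus> d (d1 x)) \<oplus> (d2 (d x) \<ominus> d (d2 x))"
    using c by algebra
  finally show "((d1 \<oplus>\<^bsub>L\<^esub> d2) \<otimes>\<^bsub>L\<^esub> d) x = (d1 \<otimes>\<^bsub>L\<^esub> d \<oplus>\<^bsub>L\<^esub> d2 \<otimes>\<^bsub>L\<^esub> d) x"
    using x by (simp add: Der_lie_mult Der_lie_add)
qed (use assms in \<open>simp_all add: add_mem_Der mult_mem_Der\<close>)

lemma bracket_add_right:
  assumes "d1 \<in> Der A" "d2 \<in> Der A" "d \<in> Der A"
  shows "d \<otimes>\<^bsub>L\<^esub> (d1 \<oplus>\<^bsub>L\<^esub> d2) = d \<otimes>\<^bsub>L\<^esub> d1 \<oplus>\<^bsub>L\<^esub> d \<otimes>\<^bsub>L\<^esub> d2"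
proof (rule Der_eqI)
  fix x assume x: "x \<in> carrier A"
  note c = x Der_closed[OF assms(1)] Der_closed[OF assms(2)] Der_closed[OF assms(3)]
  have "(d \<otimes>\<^bsub>L\<^esub> (d1 \<oplus>\<^bsub>L\<^esub> d2)) x = d (d1 x) \<oplus> d (d2 x) \<ominus> (d1 (d x) \<oplus> d2 (d x))"
    using c assms by (simp add: Der_lie_mult Der_lie_add Der_add)
  also have "\<dots> = (d (d1 x) \<ominus> d1 (d x)) \<oplus> (d (d2 x) \<ominus> d2 (d x))"
    using c by algebra
  finally show "(d \<otimes>\<^bsub>L\<^esub> (d1 \<oplus>\<^bsub>L\<^esub> d2)) x = (d \<otimes>\<^bsub>L\<^esub> d1 \<oplus>\<^bsub>L\<^esub> d \<otimes>\<^bsub>L\<^esub> d2) x"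
    using x by (simp add: Der_lie_mult Der_lie_add)
qed (use assms in \<open>simp_all add: add_mem_Der mult_mem_Der\<close>)

text \<open>The Leibniz rule lets d fall on b or on the argument; the latter terms are exactly those
  of \<open>ad b (d x)\<close> and cancel.\<close>

lemma bracket_Der_ad:
  assumes d: "d \<in> Der A" and b: "b \<in> carrier A"
  shows "d \<otimes>\<^bsub>L\<^esub> ad b = ad (d b)"
proof (rule Der_eqI)
  fix x assume x: "x \<in> carrier A"
  note c = x b Der_closed[OF d]
  have "(d \<otimes>\<^bsub>L\<^esub> ad b) x = (d b \<otimes> x \<oplus> b \<otimes> d x) \<ominus> (d x \<otimes> b \<oplus> x \<otimes> d b) \<ominus> (b \<otimes> d x \<ominus> d x \<otimes> b)"
    using c d by (simp add: Der_lie_mult ad_def Der_diff Der_mult)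
  also have "\<dots> = d b \<otimes> x \<ominus> x \<otimes> d b"
    using c by algebra
  finally show "(d \<otimes>\<^bsub>L\<^esub> ad b) x = ad (d b) x"
    using x by (simp add: ad_def)
qed (use assms in \<open>simp_all add: mult_mem_Der ad_mem_Der\<close>)

text \<open>The mirror image of \<open>bracket_Der_ad\<close>. The sign is kept inside
  \<open>ad\<close>, so that the result is visibly an element of \<open>Inn A\<close>.\<close>

lemma bracket_ad_Der:
  assumes d: "d \<in> Der A" and a: "a \<in> carrier A"
  shows "ad a \<otimes>\<^bsub>L\<^esub> d = ad (\<ominus> d a)"
proof (rule Der_eqI)
  fix x assume x: "x \<in> carrier A"
  note c = x a Der_closed[OF d]
  have "(ad a \<otimes>\<^bsub>L\<^esub> d) x = (a \<otimes> d x \<ominus> d x \<otimes> a) \<ominus> ((d a \<otimes> x \<oplus> a \<otimes> d x) \<ominus> (d x \<otimes> a \<oplus> x \<otimes> d a))"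
    using c d by (simp add: Der_lie_mult ad_def Der_diff Der_mult)
  also have "\<dots> = (\<ominus> d a) \<otimes> x \<ominus> x \<otimes> (\<ominus> d a)"
    using c by algebra
  finally show "(ad a \<otimes>\<^bsub>L\<^esub> d) x = ad (\<ominus> d a) x"
    using x by (simp add: ad_def)
qed (use assms in \<open>simp_all add: mult_mem_Der ad_mem_Der\<close>)

section \<open>Cosets modulo the inner derivations\<close>

lemma Inn_abelian_subgroup: "abelian_subgroup (Inn A) L"
proof -
  interpret L: abelian_group L by (rule Der_lie_abelian_group)
  have inv: "\<ominus>\<^bsub>L\<^esub> ad a = ad (\<ominus> a)" if "a \<in> carrier A" for a
    using that by (intro L.minus_equality)
      (simp_all add: ad_add ad_zero l_neg ad_mem_Der Der_lie_sel(1))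
  have "subgroup (Inn A) (add_monoid L)"
    by (rule L.add.subgroupI)
      (auto simp: Inn_eq Der_lie_sel(1) ad_mem_Der ad_add inv a_inv_def[symmetric])
  then show ?thesis
    by (intro abelian_subgroupI3 additive_subgroupI Der_lie_abelian_group)
qed

text \<open>Expanding bilinearly, every term that contains n or n' is inner, because
  \<open>Inn A\<close> absorbs brackets with derivations. Both representatives vary at once, as the
  definition of \<open>rcoset_mult\<close> demands.\<close>

lemma bracket_rcos_Inn:
  assumes n: "n \<in> Inn A" "n' \<in> Inn A" and d: "d \<in> Der A" "d' \<in> Der A"
  shows "(n \<oplus>\<^bsub>L\<^esub> d) \<otimes>\<^bsub>L\<^esub> (n' \<oplus>\<^bsub>L\<^esub> d') \<in> Inn A +>\<^bsub>L\<^esub> (d \<otimes>\<^bsub>L\<^esub> d')"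
proof -
  interpret N: abelian_subgroup "Inn A" L by (rule Inn_abelian_subgroup)
  have n': "n \<in> Der A" "n' \<in> Der A"
    using n by (auto simp: Inn_eq ad_mem_Der)
  have m: "n \<otimes>\<^bsub>L\<^esub> (n' \<oplus>\<^bsub>L\<^esub> d') \<in> Inn A" "d \<otimes>\<^bsub>L\<^esub> n' \<in> Inn A"
    using n d by (auto simp: Inn_eq bracket_ad_Der bracket_Der_ad add_mem_Der ad_mem_Der)
  have "(n \<oplus>\<^bsub>L\<^esub> d) \<otimes>\<^bsub>L\<^esub> (n' \<oplus>\<^bsub>L\<^esub> d') =
      (n \<otimes>\<^bsub>L\<^esub> (n' \<oplus>\<^bsub>L\<^esub> d') \<oplus>\<^bsub>L\<^esub> d \<otimes>\<^bsub>L\<^esub> n') \<oplus>\<^bsub>L\<^esub> d \<otimes>\<^bsub>L\<^esub> d'"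
    using n' d by (simp add: bracket_add_left bracket_add_right add_mem_Der mult_mem_Der
        N.a_ac Der_lie_sel(1))
  then show ?thesis
    using m by (auto simp: a_r_coset_def')
qed

end

text \<open>\<open>quot_alg\<close> defines scalar multiplication as a union over all
  representatives. If f sends a whole coset into one coset, all members of the union agree, and the
  union is nonempty since x lies in its own coset.\<close>

lemma (in abelian_subgroup) rcos_UN:
  assumes "x \<in> carrier G" "f x \<in> carrier G" "\<And>h. h \<in> H \<Longrightarrow> f (h \<oplus> x) \<in> H +> f x"
  shows "(\<Union>y\<in>H +> x. H +> f y) = H +> f x"
proof -
  have "H +> f y = H +> f x" if "y \<in> H +> x" for y
    using that assms a_repr_independence'[of "f y" "f x"] by (auto simp: a_r_coset_def')
  then have "(\<Union>y\<in>H +> x. H +> f y) = (\<Union>y\<in>H +> x. H +> f x)"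
    by (intro SUP_cong refl)
  then show ?thesis
    using a_rcos_self[OF assms(1)] by blast
qed

context k_algebra
begin

lemma HH1_simps:
  assumes d: "d \<in> Der A" "d' \<in> Der A"
  shows "(Inn A +>\<^bsub>L\<^esub> d) \<oplus>\<^bsub>HH1 A\<^esub> (Inn A +>\<^bsub>L\<^esub> d') = Inn A +>\<^bsub>L\<^esub> (d \<oplus>\<^bsub>L\<^esub> d')"
    and "c \<odot>\<^bsub>HH1 A\<^esub> (Inn A +>\<^bsub>L\<^esub> d) = Inn A +>\<^bsub>L\<^esub> (c \<odot>\<^bsub>L\<^esub> d)"
    and "(Inn A +>\<^bsub>L\<^esub> d) \<otimes>\<^bsub>HH1 A\<^esub> (Inn A +>\<^bsub>L\<^esub> d') = Inn A +>\<^bsub>L\<^esub> (d \<otimes>\<^bsub>L\<^esub> d')"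
proof -
  interpret N: abelian_subgroup "Inn A" L by (rule Inn_abelian_subgroup)
  show "(Inn A +>\<^bsub>L\<^esub> d) \<oplus>\<^bsub>HH1 A\<^esub> (Inn A +>\<^bsub>L\<^esub> d') = Inn A +>\<^bsub>L\<^esub> (d \<oplus>\<^bsub>L\<^esub> d')"
    using d by (simp add: HH1_def quot_alg_def N.a_rcos_sum Der_lie_sel(1))
  have Inn: "n \<in> Der A" if "n \<in> Inn A" for n
    using that by (auto simp: Inn_eq ad_mem_Der)
  have "c \<odot>\<^bsub>L\<^esub> (n \<oplus>\<^bsub>L\<^esub> d) = c \<odot>\<^bsub>L\<^esub> n \<oplus>\<^bsub>L\<^esub> c \<odot>\<^bsub>L\<^esub> d" if "n \<in> Inn A" for n
    using that d by (intro Der_eqI)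
      (simp_all add: Inn add_mem_Der smult_mem_Der Der_lie_add Der_lie_smult smult_r_distr)
  moreover have "c \<odot>\<^bsub>L\<^esub> n \<in> Inn A" if "n \<in> Inn A" for n
    using that by (auto simp: Inn_eq ad_smult)
  ultimately have "(\<Union>y\<in>Inn A +>\<^bsub>L\<^esub> d. Inn A +>\<^bsub>L\<^esub> (c \<odot>\<^bsub>L\<^esub> y)) = Inn A +>\<^bsub>L\<^esub> (c \<odot>\<^bsub>L\<^esub> d)"
    using d by (intro N.rcos_UN) (auto simp: Der_lie_sel(1) smult_mem_Der a_r_coset_def')
  then show "c \<odot>\<^bsub>HH1 A\<^esub> (Inn A +>\<^bsub>L\<^esub> d) = Inn A +>\<^bsub>L\<^esub> (c \<odot>\<^bsub>L\<^esub> d)"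
    by (simp add: HH1_def quot_alg_def)
  have "Inn A +>\<^bsub>L\<^esub> (a \<otimes>\<^bsub>L\<^esub> b) = Inn A +>\<^bsub>L\<^esub> (d \<otimes>\<^bsub>L\<^esub> d')"
    if "a \<in> Inn A +>\<^bsub>L\<^esub> d" "b \<in> Inn A +>\<^bsub>L\<^esub> d'" for a b
  proof -
    have "a \<otimes>\<^bsub>L\<^esub> b \<in> Inn A +>\<^bsub>L\<^esub> (d \<otimes>\<^bsub>L\<^esub> d')"
      using that bracket_rcos_Inn[OF _ _ d] by (auto simp: a_r_coset_def')
    then show ?thesis
      using d by (intro N.a_repr_independence'[symmetric]) (auto simp: Der_lie_sel(1) mult_mem_Der)
  qed
  moreover have "d \<in> Inn A +>\<^bsub>L\<^esub> d" "d' \<in> Inn A +>\<^bsub>L\<^esub> d'"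
    using d by (auto intro!: N.a_rcos_self simp: Der_lie_sel(1))
  ultimately have "rcoset_mult L (Inn A) (Inn A +>\<^bsub>L\<^esub> d) (Inn A +>\<^bsub>L\<^esub> d') = Inn A +>\<^bsub>L\<^esub> (d \<otimes>\<^bsub>L\<^esub> d')"
    unfolding rcoset_mult_def by blast
  then show "(Inn A +>\<^bsub>L\<^esub> d) \<otimes>\<^bsub>HH1 A\<^esub> (Inn A +>\<^bsub>L\<^esub> d') = Inn A +>\<^bsub>L\<^esub> (d \<otimes>\<^bsub>L\<^esub> d')"
    by (simp add: HH1_def quot_alg_def)
qed

section \<open>Solvability from a descending chain\<close>

lemma HH1_sel:
  "carrier (HH1 A) = (\<lambda>d. Inn A +>\<^bsub>L\<^esub> d) ` Der A" "\<zero>\<^bsub>HH1 A\<^esub> = Inn A"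
  by (auto simp: HH1_def quot_alg_def A_RCOSETS_def' Der_lie_sel(1))

text \<open>By induction the n-th derived term lies in the image of \<open>D n\<close>. A derived
  term is a linear span of brackets, hence the closure of every \<open>D n\<close> under addition
  and scalars.\<close>

lemma lie_solvable_HH1I:
  fixes D :: "nat \<Rightarrow> ('b \<Rightarrow> 'b) set"
  assumes D0: "D 0 = Der A"
    and Der: "\<And>n. D n \<subseteq> Der A"
    and zero: "\<And>n. \<zero>\<^bsub>L\<^esub> \<in> D n"
    and add: "\<And>n d d'. d \<in> D n \<Longrightarrow> d' \<in> D n \<Longrightarrow> d \<oplus>\<^bsub>L\<^esub> d' \<in> D n"
    and smult: "\<And>n c d. d \<in> D n \<Longrightarrow> c \<odot>\<^bsub>L\<^esub> d \<in> D n"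
    and bracket: "\<And>n d d'. d \<in> D n \<Longrightarrow> d' \<in> D n \<Longrightarrow> d \<otimes>\<^bsub>L\<^esub> d' \<in> D (Suc n)"
    and Dm: "D m \<subseteq> {\<zero>\<^bsub>L\<^esub>}"
  shows "lie_solvable (HH1 A)"
proof -
  interpret N: abelian_subgroup "Inn A" L by (rule Inn_abelian_subgroup)
  let ?q = "\<lambda>d. Inn A +>\<^bsub>L\<^esub> d"
  have q0: "?q \<zero>\<^bsub>L\<^esub> = Inn A"
    by (rule N.a_rcos_const) simp
  have sub: "derived_series (HH1 A) n \<subseteq> ?q ` D n" for n
  proof (induction n)
    case 0
    then show ?case by (simp add: HH1_sel D0)
  next
    case (Suc n)
    show ?case
    proof
      fix z assume "z \<in> derived_series (HH1 A) (Suc n)"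
      then have "z \<in> lin_span (HH1 A) {x \<otimes>\<^bsub>HH1 A\<^esub> y |x y.
          x \<in> derived_series (HH1 A) n \<and> y \<in> derived_series (HH1 A) n}"
        by simp
      then show "z \<in> ?q ` D (Suc n)"
      proof induction
        case span_zero
        show ?case
          using zero[of "Suc n"] q0 by (force simp: HH1_sel)
      next
        case (span_base x)
        then obtain d d' where "d \<in> D n" "d' \<in> D n" "x = ?q d \<otimes>\<^bsub>HH1 A\<^esub> ?q d'"
          using Suc.IH by blast
        then have "x = ?q (d \<otimes>\<^bsub>L\<^esub> d')" "d \<otimes>\<^bsub>L\<^esub> d' \<in> D (Suc n)"
          using HH1_simps(3) Der bracket by blast+
        then show ?case by blast
      next
        case (span_add x y)
        then obtain d d' where dd: "d \<in> D (Suc n)" "d' \<in> D (Suc n)" "x = ?q d" "y = ?q d'"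
          by blast
        then have "x \<oplus>\<^bsub>HH1 A\<^esub> y = ?q (d \<oplus>\<^bsub>L\<^esub> d')"
          using HH1_simps(1) Der by blast
        then show ?case using add dd by blast
      next
        case (span_smult x c)
        then obtain d where dd: "d \<in> D (Suc n)" "x = ?q d"
          by blast
        then have "c \<odot>\<^bsub>HH1 A\<^esub> x = ?q (c \<odot>\<^bsub>L\<^esub> d)"
          using HH1_simps(2) Der by blast
        then show ?case using smult dd by blast
      qed
    qed
  qed
  \<comment> \<open>\<open>lie_solvable\<close> asks for equality with {0}, so zero must also be
    exhibited: as the class of the zero derivation at stage 0, and by \<open>span_zero\<close> at
    later stages.\<close>
  have "Inn A \<in> derived_series (HH1 A) m"
    using zero[of 0] q0 lin_span.span_zero[of "HH1 A"] D0
    by (cases m) (force simp: HH1_sel)+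
  moreover have "derived_series (HH1 A) m \<subseteq> {Inn A}"
    using sub[of m] Dm q0 by force
  ultimately show ?thesis
    unfolding lie_solvable_def HH1_sel by blast
qed

text \<open>Derivations are graded by how far they push the filtration. The last hypothesis is the
  only source of a gain at the start; after that the degrees of the two factors of a bracket add
  up.\<close>

lemma lie_solvable_HH1_filtration:
  fixes F :: "nat \<Rightarrow> 'b set"
  assumes F0: "F 0 = carrier A"
    and F_anti: "\<And>i j. i \<le> j \<Longrightarrow> F j \<subseteq> F i"
    and F_zero: "\<And>i. \<zero> \<in> F i"
    and F_add: "\<And>i x y. x \<in> F i \<Longrightarrow> y \<in> F i \<Longrightarrow> x \<oplus> y \<in> F i"
    and F_smult: "\<And>i c x. x \<in> F i \<Longrightarrow> c \<odot> x \<in> F i"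
    and Fm: "F m \<subseteq> {\<zero>}"
    and Der: "\<And>d i x. d \<in> Der A \<Longrightarrow> x \<in> F i \<Longrightarrow> d x \<in> F i"
    and bracket: "\<And>d d' i x. d \<in> Der A \<Longrightarrow> d' \<in> Der A \<Longrightarrow> x \<in> F i \<Longrightarrow>
      (d \<otimes>\<^bsub>L\<^esub> d') x \<in> F (Suc i)"
  shows "lie_solvable (HH1 A)"
proof -
  define D where "D n = {d \<in> Der A. \<forall>i. \<forall>x\<in>F i. d x \<in> F (i + n)}" for n
  have F_carrier: "x \<in> carrier A" if "x \<in> F i" for x i
    using that F_anti[of 0 i] F0 by auto
  have F_minus: "x \<ominus> y \<in> F i" if "x \<in> F i" "y \<in> F i" for x y i
  proof -
    show ?thesis
      using F_add[OF that(1) F_smult[OF that(2), of "-1"]] F_carrier[OF that(2)]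
      by (simp add: minus_eq smult_neg_one)
  qed
  have bracket_D: "d \<otimes>\<^bsub>L\<^esub> d' \<in> D (k + l)" if "d \<in> D k" "d' \<in> D l" for d d' k l
  proof -
    have "(d \<otimes>\<^bsub>L\<^esub> d') x \<in> F (i + (k + l))" if x: "x \<in> F i" for x i
    proof -
      have "d (d' x) \<in> F (i + l + k)" "d' (d x) \<in> F (i + k + l)"
        using x \<open>d \<in> D k\<close> \<open>d' \<in> D l\<close> unfolding D_def by blast+
      then show ?thesis
        using F_carrier[OF x] F_minus by (simp add: Der_lie_mult ac_simps)
    qed
    then show ?thesis
      using that unfolding D_def by (simp add: mult_mem_Der)
  qed
  have D_anti: "D l \<subseteq> D k" if "k \<le> l" for k l
  proof
    fix d assume "d \<in> D l"
    moreover have "F (i + l) \<subseteq> F (i + k)" for i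
      using that by (intro F_anti) simp
    ultimately show "d \<in> D k"
      unfolding D_def by blast
  qed
  show ?thesis
  proof (rule lie_solvable_HH1I[of D m])
    show D0: "D 0 = Der A"
      using Der by (auto simp: D_def)
    fix d d' n assume d: "d \<in> D n" "d' \<in> D n"
    show "d \<otimes>\<^bsub>L\<^esub> d' \<in> D (Suc n)"
    \<comment> \<open>Degrees add to n + n, which is at least n + 1 exactly when n is positive; the
      case n = 0 is therefore the one that calls on \<open>bracket\<close>.\<close>
    proof (cases n)
      case 0
      with d show ?thesis
        using bracket D0 by (simp add: D_def mult_mem_Der)
    next
      case (Suc k)
      then have "D (n + n) \<subseteq> D (Suc n)" by (intro D_anti) simp
      with bracket_D d show ?thesis by blast
    qed
  next
    show "D m \<subseteq> {\<zero>\<^bsub>L\<^esub>}"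
    proof
      fix d assume d: "d \<in> D m"
      then have "d x = \<zero>" if "x \<in> carrier A" for x
        \<comment> \<open>Instantiated at i = 0: all of A is \<open>F 0\<close>, and d moves it into
          \<open>F m\<close>, which is zero.\<close>
        using that Fm F0 by (fastforce simp: D_def dest: spec[of _ 0])
      then have "d = \<zero>\<^bsub>L\<^esub>"
        using d by (intro Der_eqI) (auto simp: D_def zero_mem_Der Der_lie_zero)
      then show "d \<in> {\<zero>\<^bsub>L\<^esub>}" by simp
    qed
  qed (auto simp: D_def zero_mem_Der add_mem_Der smult_mem_Der Der_lie_zero Der_lie_add
      Der_lie_smult F_carrier F_zero F_add F_smult)
qed

end

section \<open>Quotients of algebras\<close>

locale k_algebra_ideal = k_algebra A + ideal I A
  for A :: "('k::field, 'b) module" (structure) and I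
begin

abbreviation B where "B \<equiv> quot_alg A I"

text \<open>A ring ideal absorbs multiplication by elements of A; a scalar c acts as the element
  \<open>c \<odot> \<one>\<close>.\<close>

lemma smult_mem_ideal:
  assumes "x \<in> I" shows "c \<odot> x \<in> I"
proof -
  have "c \<odot> x = (c \<odot> \<one>) \<otimes> x"
    using assms by (simp add: smult_mult_l)
  then show ?thesis
    using assms by (simp add: I_l_closed)
qed

lemma quot_sel:
  "carrier B = (\<lambda>x. I +> x) ` carrier A" "\<zero>\<^bsub>B\<^esub> = I" "\<one>\<^bsub>B\<^esub> = I +> \<one>"
  by (auto simp: quot_alg_def A_RCOSETS_def')

lemma
  assumes x: "x \<in> carrier A"
  shows quot_add: "y \<in> carrier A \<Longrightarrow> (I +> x) \<oplus>\<^bsub>B\<^esub> (I +> y) = I +> (x \<oplus> y)"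
    and quot_mult: "y \<in> carrier A \<Longrightarrow> (I +> x) \<otimes>\<^bsub>B\<^esub> (I +> y) = I +> (x \<otimes> y)"
    and quot_smult: "c \<odot>\<^bsub>B\<^esub> (I +> x) = I +> (c \<odot> x)"
proof -
  show "(I +> x) \<oplus>\<^bsub>B\<^esub> (I +> y) = I +> (x \<oplus> y)" if "y \<in> carrier A"
    using x that by (simp add: quot_alg_def a_rcos_sum)
  show "(I +> x) \<otimes>\<^bsub>B\<^esub> (I +> y) = I +> (x \<otimes> y)" if "y \<in> carrier A"
    using x that by (simp add: quot_alg_def rcoset_mult_add)
  have "(\<Union>y\<in>I +> x. I +> (c \<odot> y)) = I +> (c \<odot> x)"
    using x by (intro rcos_UN) (auto simp: smult_r_distr smult_mem_ideal a_r_coset_def')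
  then show "c \<odot>\<^bsub>B\<^esub> (I +> x) = I +> (c \<odot> x)"
    by (simp add: quot_alg_def)
qed

lemma ring_quot: "ring B"
proof (rule ringI)
  have zero: "I = I +> \<zero>"
    by (simp add: a_rcos_const)
  show "abelian_group B"
  proof (rule abelian_groupI)
    fix x assume "x \<in> carrier B"
    then obtain a where a: "a \<in> carrier A" "x = I +> a"
      by (auto simp: quot_sel)
    then have "(I +> (\<ominus> a)) \<oplus>\<^bsub>B\<^esub> x = \<zero>\<^bsub>B\<^esub>"
      using zero by (simp add: quot_add quot_sel l_neg)
    then show "\<exists>y\<in>carrier B. y \<oplus>\<^bsub>B\<^esub> x = \<zero>\<^bsub>B\<^esub>"
      using a by (auto simp: quot_sel)
    show "\<zero>\<^bsub>B\<^esub> \<oplus>\<^bsub>B\<^esub> x = x"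
      using a zero quot_add[of \<zero> a] by (simp add: quot_sel)
  next
    show "\<zero>\<^bsub>B\<^esub> \<in> carrier B"
      using zero by (auto simp: quot_sel)
  qed (auto simp: quot_sel(1) quot_add a_ac)
  show "Group.monoid B"
    by (rule monoidI) (auto simp: quot_sel quot_mult m_assoc)
qed (auto simp: quot_sel quot_mult quot_add l_distr r_distr)

lemma k_algebra_quot: "k_algebra B"
  by (intro k_algebra.intro ring_quot k_algebra_axioms.intro)
    (auto simp: quot_sel quot_mult quot_add quot_smult smult_l_distr smult_r_distr smult_assoc
      smult_one smult_mult_l smult_mult_r)

end

section \<open>Path algebras\<close>

lemma single_eq_0_iff: "single p q = (0 :: 'k::field) \<longleftrightarrow> q \<noteq> p"
  by (simp add: single_def)

lemma path_algebra_sel: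
  "carrier (path_algebra Q) = {f. finite {p. f p \<noteq> 0} \<and> {p. f p \<noteq> 0} \<subseteq> paths Q}"
  "\<zero>\<^bsub>path_algebra Q\<^esub> = (\<lambda>p. 0)"
  "f \<oplus>\<^bsub>path_algebra Q\<^esub> g = (\<lambda>p. f p + g p)"
  "c \<odot>\<^bsub>path_algebra Q\<^esub> f = (\<lambda>p. c * f p)"
  by (simp_all add: path_algebra_def)

lemma path_algebra_mult:
  "(f \<otimes>\<^bsub>path_algebra Q\<^esub> g) (u, w) =
    (\<Sum>i\<le>length w. f (u, take i w) * g (pre_digraph.awlast Q u (take i w), drop i w))"
  by (simp add: path_algebra_def)

lemma k_algebra_path_algebra:
  fixes Q :: "('v, 'a) pre_digraph"
  assumes "ring (path_algebra Q :: ('k::field, _) module)"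
  shows "k_algebra (path_algebra Q :: ('k, _) module)"
proof (intro k_algebra.intro assms k_algebra_axioms.intro)
  fix x y :: "('v, 'a) path \<Rightarrow> 'k" and c :: 'k
  show "c \<odot>\<^bsub>path_algebra Q\<^esub> x \<in> carrier (path_algebra Q)" if "x \<in> carrier (path_algebra Q)"
    using that by (auto simp: path_algebra_sel elim!: rev_finite_subset)
  show "(c \<odot>\<^bsub>path_algebra Q\<^esub> x) \<otimes>\<^bsub>path_algebra Q\<^esub> y = c \<odot>\<^bsub>path_algebra Q\<^esub> (x \<otimes>\<^bsub>path_algebra Q\<^esub> y)"
    by (rule ext) (auto simp: path_algebra_mult path_algebra_sel(4) sum_distrib_left mult.assoc)
  show "x \<otimes>\<^bsub>path_algebra Q\<^esub> (c \<odot>\<^bsub>path_algebra Q\<^esub> y) = c \<odot>\<^bsub>path_algebra Q\<^esub> (x \<otimes>\<^bsub>path_algebra Q\<^esub> y)"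
    by (rule ext) (auto simp: path_algebra_mult path_algebra_sel(4) sum_distrib_left mult.left_commute)
qed (simp_all add: path_algebra_sel algebra_simps)

text \<open>Membership in a span of paths becomes a condition on supports; conversely, claims about
  functions with a given support can be proved by induction over the span.\<close>

lemma lin_span_single:
  fixes Q :: "('v, 'a) pre_digraph"
  shows "lin_span (path_algebra Q) (single ` T) =
    {f :: ('v, 'a) path \<Rightarrow> 'k::field. finite {p. f p \<noteq> 0} \<and> {p. f p \<noteq> 0} \<subseteq> T}" (is "?S = ?R")
proof
  show "?S \<subseteq> ?R"
  proof
    fix f :: "('v, 'a) path \<Rightarrow> 'k" assume "f \<in> ?S"
    then show "f \<in> ?R"
    proof induction
      case (span_add x y)
      then have "finite ({p. x p \<noteq> 0} \<union> {p. y p \<noteq> 0})" "{p. x p \<noteq> 0} \<union> {p. y p \<noteq> 0} \<subseteq> T"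
        by auto
      moreover have "{p. x p + y p \<noteq> 0} \<subseteq> {p. x p \<noteq> 0} \<union> {p. y p \<noteq> 0}"
        by auto
      ultimately have "finite {p. x p + y p \<noteq> 0}" "{p. x p + y p \<noteq> 0} \<subseteq> T"
        using finite_subset by blast+
      then show ?case
        by (simp add: path_algebra_sel)
    next
      case (span_smult x c)
      then show ?case
        by (auto simp: path_algebra_sel elim!: rev_finite_subset)
    qed (auto simp: path_algebra_sel single_eq_0_iff)
  qed
  show "?R \<subseteq> ?S"
  proof
    fix f :: "('v, 'a) path \<Rightarrow> 'k" assume "f \<in> ?R"
    \<comment> \<open>The induction runs over a finite set containing the support, with f arbitrary,
      so that dropping a path p is a mere update of f.\<close>
    moreover have "finite S \<Longrightarrow> {p. f p \<noteq> 0} \<subseteq> S \<Longrightarrow> S \<subseteq> T \<Longrightarrow> f \<in> ?S" for S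
    proof (induction S arbitrary: f rule: finite_induct)
      case empty
      then have "f = \<zero>\<^bsub>path_algebra Q\<^esub>"
        by (auto simp: path_algebra_sel)
      then show ?case
        by (simp add: lin_span.span_zero)
    next
      case (insert p S)
      have "f(p := 0) \<in> ?S"
        using insert by (intro insert.IH) (auto split: if_splits)
      moreover have "f p \<odot>\<^bsub>path_algebra Q\<^esub> single p \<in> ?S"
        using insert.prems by (intro lin_span.span_smult lin_span.span_base) auto
      moreover have "f = f(p := 0) \<oplus>\<^bsub>path_algebra Q\<^esub> (f p \<odot>\<^bsub>path_algebra Q\<^esub> single p)"
        by (auto simp: path_algebra_sel single_def)
      ultimately show ?case
        by (metis lin_span.span_add)
    qed
    ultimately show "f \<in> ?S" by auto
  qed
qed

lemma mem_arrow_ideal_pow: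
  "f \<in> arrow_ideal_pow Q k \<longleftrightarrow>
    f \<in> carrier (path_algebra Q) \<and> (\<forall>p. f p \<noteq> 0 \<longrightarrow> k \<le> path_len p)"
proof -
  have eq: "{single p |p. p \<in> paths Q \<and> k \<le> path_len p} = single ` {p \<in> paths Q. k \<le> path_len p}"
    by blast
  show ?thesis
    unfolding arrow_ideal_pow_def eq lin_span_single path_algebra_sel by auto
qed

text \<open>
  Associativity of the convolution is not proved: being an ideal includes that the ambient
  structure is a ring.
\<close>

locale local_quiver_algebra = fin_digraph Q for Q :: "('v, 'a) pre_digraph" +
  fixes e :: 'v and I :: "(('v, 'a) path \<Rightarrow> 'k::field) set"
  assumes verts_Q: "verts Q = {e}"
    and admissible: "admissible_ideal Q I"
begin

abbreviation P :: "('k, ('v, 'a) path \<Rightarrow> 'k) module" where "P \<equiv> path_algebra Q"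
abbreviation A where "A \<equiv> quiver_algebra Q I"
abbreviation V :: "nat \<Rightarrow> (('v, 'a) path \<Rightarrow> 'k) set" where "V \<equiv> arrow_ideal_pow Q"

sublocale P: k_algebra_ideal P I
  using admissible k_algebra_path_algebra ideal.axioms(2)
  unfolding admissible_ideal_def k_algebra_ideal_def by blast

sublocale A: k_algebra A
  unfolding quiver_algebra_def by (rule P.k_algebra_quot)

lemmas A_sel = P.quot_sel[folded quiver_algebra_def]
  and A_add = P.quot_add[folded quiver_algebra_def]
  and A_mult = P.quot_mult[folded quiver_algebra_def]
  and A_smult = P.quot_smult[folded quiver_algebra_def]

section \<open>Paths in a quiver with one vertex\<close>

lemma ends: "a \<in> arcs Q \<Longrightarrow> tail Q a = e" "a \<in> arcs Q \<Longrightarrow> head Q a = e"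
  using verts_Q tail_in_verts head_in_verts by blast+

text \<open>All arrows are loops at e, so any word in the arrows is composable. Hence paths are
  words, and every path is parallel to every arrow.\<close>

lemma cas_e: "set w \<subseteq> arcs Q \<Longrightarrow> cas e w v \<longleftrightarrow> v = e"
  by (induction w) (auto simp: ends)

lemma is_path_iff: "is_path Q u p v \<longleftrightarrow> u = e \<and> v = e \<and> fst p = e \<and> set (snd p) \<subseteq> arcs Q"
  using cas_e[of "snd p" v] by (auto simp: is_path_def awalk_def verts_Q)

lemma mem_paths: "(u, w) \<in> paths Q \<longleftrightarrow> u = e \<and> set w \<subseteq> arcs Q"
  by (auto simp: paths_def is_path_iff)

lemma arrow_path_eq: "a \<in> arcs Q \<Longrightarrow> arrow_path Q a = (e, [a])"
  by (simp add: arrow_path_def ends)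

lemma single_carrier: "p \<in> paths Q \<Longrightarrow> single p \<in> carrier P"
  by (auto simp: path_algebra_sel single_eq_0_iff)

lemma single_V: "p \<in> paths Q \<Longrightarrow> k \<le> path_len p \<Longrightarrow> single p \<in> V k"
  by (auto simp: mem_arrow_ideal_pow single_carrier single_eq_0_iff)

lemma one_eq: "\<one>\<^bsub>P\<^esub> = single (e, [])"
  by (auto simp: path_algebra_def verts_Q single_def)

lemma single_mult:
  assumes a: "a \<in> arcs Q"
  shows "single (e, [a]) \<otimes>\<^bsub>P\<^esub> single (e, w) = single (e, a # w)"
proof
  fix p :: "('v, 'a) path"
  obtain u v where p: "p = (u, v)" by (cases p)
  \<comment> \<open>Of all cuts of v only the one after its first arrow can contribute, and it does
    so only if v is the word \<open>a # w\<close>.\<close>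
  have "single (e, [a]) (u, take i v) * single (e, w) (awlast u (take i v), drop i v) =
      (if i = 1 then if p = (e, a # w) then 1 else (0 :: 'k) else 0)" if "i \<le> length v" for i
  proof (cases "u = e \<and> take i v = [a]")
    case True
    then have "length (take i v) = 1" by simp
    then have "i = 1" using that by simp
    moreover from this obtain v' where "v = a # v'"
      using True by (cases v) auto
    ultimately show ?thesis
      using True a by (auto simp: single_def p ends)
  next
    case False
    then have "single (e, [a]) (u, take i v) = (0 :: 'k)"
      by (auto simp: single_def)
    moreover have "\<not> (i = 1 \<and> p = (e, a # w))"
      using False p by auto
    ultimately show ?thesis
      by auto
  qed
  then have "(single (e, [a]) \<otimes>\<^bsub>P\<^esub> single (e, w)) p =
      (\<Sum>i\<le>length v. if i = 1 then if p = (e, a # w) then 1 else (0 :: 'k) else 0)"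
    unfolding p path_algebra_mult by (intro sum.cong) auto
  also have "\<dots> = single (e, a # w) p"
    by (auto simp: single_def p)
  finally show "(single (e, [a]) \<otimes>\<^bsub>P\<^esub> single (e, w)) p = single (e, a # w) p" .
qed

section \<open>Powers of the arrow ideal in A\<close>

lemma V_carrier: "f \<in> V k \<Longrightarrow> f \<in> carrier P"
  by (simp add: mem_arrow_ideal_pow)

lemma V_mult:
  assumes "f \<in> V k" "g \<in> V l"
  shows "f \<otimes>\<^bsub>P\<^esub> g \<in> V (k + l)"
proof -
  have "k + l \<le> length w" if "(f \<otimes>\<^bsub>P\<^esub> g) (u, w) \<noteq> 0" for u w
  proof -
    obtain i where i: "i \<le> length w"
      "f (u, take i w) * g (pre_digraph.awlast Q u (take i w), drop i w) \<noteq> 0"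
      using \<open>(f \<otimes>\<^bsub>P\<^esub> g) (u, w) \<noteq> 0\<close> unfolding path_algebra_mult
      by (meson atMost_iff sum.not_neutral_contains_not_neutral)
    then have "k \<le> path_len (u, take i w)"
      "l \<le> path_len (pre_digraph.awlast Q u (take i w), drop i w)"
      using assms unfolding mem_arrow_ideal_pow by (metis mult_eq_0_iff)+
    then show ?thesis using i by simp
  qed
  then show ?thesis
    using assms by (auto simp: mem_arrow_ideal_pow)
qed

text \<open>This is the power J^k, described by representatives: the image in A of the span of the
  paths of length at least k. For k = 0 it is A itself, and admissibility makes it vanish for some
  k.\<close>

definition F :: "nat \<Rightarrow> (('v, 'a) path \<Rightarrow> 'k) set set" where
  "F k = (\<lambda>f. I +>\<^bsub>P\<^esub> f) ` V k"

lemma F_carrier: "x \<in> F k \<Longrightarrow> x \<in> carrier A"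
  by (auto simp: F_def A_sel V_carrier)

lemma F_0: "F 0 = carrier A"
  by (auto simp: F_def A_sel mem_arrow_ideal_pow)

lemma F_anti: "k \<le> l \<Longrightarrow> F l \<subseteq> F k"
  by (force simp: F_def mem_arrow_ideal_pow)

lemma F_zero: "\<zero>\<^bsub>A\<^esub> \<in> F k"
proof -
  have "\<zero>\<^bsub>P\<^esub> \<in> V k"
    by (auto simp: mem_arrow_ideal_pow path_algebra_sel)
  moreover have "\<zero>\<^bsub>A\<^esub> = I +>\<^bsub>P\<^esub> \<zero>\<^bsub>P\<^esub>"
    by (simp add: A_sel P.a_rcos_const)
  ultimately show ?thesis
    unfolding F_def by blast
qed

lemma F_add:
  assumes "x \<in> F k" "y \<in> F k"
  shows "x \<oplus>\<^bsub>A\<^esub> y \<in> F k"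
proof -
  obtain f g where f: "f \<in> V k" "g \<in> V k" "x = I +>\<^bsub>P\<^esub> f" "y = I +>\<^bsub>P\<^esub> g"
    using assms by (auto simp: F_def)
  then have "x \<oplus>\<^bsub>A\<^esub> y = I +>\<^bsub>P\<^esub> (f \<oplus>\<^bsub>P\<^esub> g)"
    by (simp add: A_add V_carrier)
  moreover have "f \<oplus>\<^bsub>P\<^esub> g \<in> V k"
    using f unfolding arrow_ideal_pow_def by (intro lin_span.span_add)
  ultimately show ?thesis
    unfolding F_def by blast
qed

lemma F_smult:
  assumes "x \<in> F k"
  shows "c \<odot>\<^bsub>A\<^esub> x \<in> F k"
proof -
  obtain f where f: "f \<in> V k" "x = I +>\<^bsub>P\<^esub> f"
    using assms by (auto simp: F_def)
  then have "c \<odot>\<^bsub>A\<^esub> x = I +>\<^bsub>P\<^esub> (c \<odot>\<^bsub>P\<^esub> f)"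
    by (simp add: A_smult V_carrier)
  moreover have "c \<odot>\<^bsub>P\<^esub> f \<in> V k"
    using f unfolding arrow_ideal_pow_def by (intro lin_span.span_smult)
  ultimately show ?thesis
    unfolding F_def by blast
qed

lemma F_mult:
  assumes "x \<in> F k" "y \<in> F l"
  shows "x \<otimes>\<^bsub>A\<^esub> y \<in> F (k + l)"
proof -
  obtain f g where f: "f \<in> V k" "g \<in> V l" "x = I +>\<^bsub>P\<^esub> f" "y = I +>\<^bsub>P\<^esub> g"
    using assms by (auto simp: F_def)
  then have "x \<otimes>\<^bsub>A\<^esub> y = I +>\<^bsub>P\<^esub> (f \<otimes>\<^bsub>P\<^esub> g)"
    by (simp add: A_mult V_carrier)
  then show ?thesis
    using V_mult f unfolding F_def by blast
qed

lemma F_nilpotent: obtains m where "F m \<subseteq> {\<zero>\<^bsub>A\<^esub>}"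
proof -
  obtain m where "V m \<subseteq> I"
    using admissible unfolding admissible_ideal_def by blast
  then have "F m \<subseteq> {\<zero>\<^bsub>A\<^esub>}"
    by (auto simp: F_def A_sel P.a_rcos_const)
  then show ?thesis by (rule that)
qed

section \<open>Derivations on classes of paths\<close>

lemma cls_carrier: "p \<in> paths Q \<Longrightarrow> cls Q I p \<in> carrier A"
  by (simp add: cls_def A_sel single_carrier)

lemma cls_F: "p \<in> paths Q \<Longrightarrow> cls Q I p \<in> F (path_len p)"
  by (auto simp: cls_def F_def single_V)

lemma cls_Nil: "cls Q I (e, []) = \<one>\<^bsub>A\<^esub>"
  by (simp add: cls_def A_sel one_eq)

lemma cls_Cons:
  assumes "a \<in> arcs Q" "set w \<subseteq> arcs Q"
  shows "cls Q I (e, a # w) = cls Q I (e, [a]) \<otimes>\<^bsub>A\<^esub> cls Q I (e, w)"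
  using assms by (simp add: cls_def A_mult single_carrier mem_paths single_mult)

text \<open>A path is a product of arrows, and the Leibniz rule replaces one arrow at a time by an
  element of \<open>F (Suc k)\<close>, a gain of k. The empty path causes no trouble since d kills
  the identity. The case k = 0 serves arbitrary derivations, k = 1 commutators.\<close>

lemma Der_shift:
  assumes d: "d \<in> Der A"
    and arrows: "\<And>a. a \<in> arcs Q \<Longrightarrow> d (cls Q I (e, [a])) \<in> F (Suc k)"
    and x: "x \<in> F i"
  shows "d x \<in> F (i + k)"
proof -
  have path: "d (cls Q I (e, w)) \<in> F (length w + k)" if "set w \<subseteq> arcs Q" for w
    using that
  proof (induction w)
    case Nil
    then show ?case
      using d by (simp add: cls_Nil A.Der_one F_zero)
  next
    case (Cons a w)
    then have aw: "(e, [a]) \<in> paths Q" "(e, w) \<in> paths Q" "a \<in> arcs Q" "set w \<subseteq> arcs Q"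
      by (auto simp: mem_paths)
    have "d (cls Q I (e, a # w)) = d (cls Q I (e, [a])) \<otimes>\<^bsub>A\<^esub> cls Q I (e, w) \<oplus>\<^bsub>A\<^esub>
        cls Q I (e, [a]) \<otimes>\<^bsub>A\<^esub> d (cls Q I (e, w))"
      using aw by (simp add: cls_Cons[OF aw(3,4)] A.Der_mult[OF d] cls_carrier)
    moreover have "d (cls Q I (e, [a])) \<otimes>\<^bsub>A\<^esub> cls Q I (e, w) \<in> F (Suc k + length w)"
      using F_mult[OF arrows cls_F] aw by fastforce
    moreover have "cls Q I (e, [a]) \<otimes>\<^bsub>A\<^esub> d (cls Q I (e, w)) \<in> F (1 + (length w + k))"
      using F_mult[OF cls_F Cons.IH] aw by fastforce
    ultimately show ?case
      using F_add by (simp add: ac_simps)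
  qed
  obtain f where f: "f \<in> V i" "x = I +>\<^bsub>P\<^esub> f"
    using x by (auto simp: F_def)
  \<comment> \<open>Membership in the carrier is carried through the induction because sums and
    multiples of cosets are computed on representatives from it.\<close>
  have "f \<in> carrier P \<and> d (I +>\<^bsub>P\<^esub> f) \<in> F (i + k)"
    using f(1) unfolding arrow_ideal_pow_def
  proof induction
    case span_zero
    then show ?case
      using d A.Der_zero[OF d] F_zero P.a_rcos_const[of "\<zero>\<^bsub>P\<^esub>"] by (simp add: A_sel)
  next
    case (span_base x)
    then obtain w where w: "set w \<subseteq> arcs Q" "i \<le> length w" "x = single (e, w)"
      by (auto simp: mem_paths)
    then have "d (I +>\<^bsub>P\<^esub> x) \<in> F (length w + k)"
      using path by (simp add: cls_def)
    then show ?case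
      using w F_anti[of "i + k" "length w + k"] by (auto simp: single_carrier mem_paths)
  next
    case (span_add x y)
    then show ?case
      by (simp add: A_add[symmetric] A.Der_add[OF d] A_sel F_add)
  next
    case (span_smult x c)
    then show ?case
      by (simp add: A_smult[symmetric] A.Der_smult[OF d] A_sel F_smult)
  qed
  then show ?thesis
    using f(2) by simp
qed

section \<open>Irreducible paths and the coefficients of derivations\<close>

text \<open>
  The order need not be well-founded: a path of length at least \<open>m\<close> lies in \<open>I\<close>, and there
  are only finitely many shorter ones.
\<close>

lemma reduce:
  assumes ord: "linear_order_on (paths Q) ord" and f: "f \<in> carrier P"
  obtains g where "g \<in> carrier P" "{p. g p \<noteq> 0} \<subseteq> basis_paths Q I ord"
    "I +>\<^bsub>P\<^esub> f = I +>\<^bsub>P\<^esub> g"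
proof -
  obtain m where m: "V m \<subseteq> I"
    using admissible unfolding admissible_ideal_def by blast
  define G where "G = {g \<in> carrier P. {p. g p \<noteq> 0} \<subseteq> basis_paths Q I ord}"
  \<comment> \<open>R is the sum of I and the span of the irreducible paths; the goal amounts to R
    being all of P.\<close>
  define R where "R = {h \<oplus>\<^bsub>P\<^esub> g |h g. h \<in> I \<and> g \<in> G}"
  have basis: "basis_paths Q I ord \<subseteq> paths Q"
    by (auto simp: basis_paths_def)
  then have G_span: "G = lin_span P (single ` basis_paths Q I ord)"
    by (auto simp: G_def lin_span_single path_algebra_sel)
  have "\<zero>\<^bsub>P\<^esub> \<in> I" by simp
  have G_carrier: "g \<in> carrier P" if "g \<in> G" for g
    using that by (simp add: G_def)
  have I_R: "h \<in> R" if "h \<in> I" for h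
  proof -
    have "\<zero>\<^bsub>P\<^esub> \<in> G" unfolding G_span by (rule lin_span.span_zero)
    moreover have "h = h \<oplus>\<^bsub>P\<^esub> \<zero>\<^bsub>P\<^esub>" using that by simp
    ultimately show ?thesis using that unfolding R_def by blast
  qed
  have R_add: "x \<oplus>\<^bsub>P\<^esub> y \<in> R" if xy: "x \<in> R" "y \<in> R" for x y
  proof -
    obtain h g h' g' where h: "h \<in> I" "h' \<in> I" "g \<in> G" "g' \<in> G"
      and "x = h \<oplus>\<^bsub>P\<^esub> g" "y = h' \<oplus>\<^bsub>P\<^esub> g'"
      using xy unfolding R_def by blast
    then have "x \<oplus>\<^bsub>P\<^esub> y = (h \<oplus>\<^bsub>P\<^esub> h') \<oplus>\<^bsub>P\<^esub> (g \<oplus>\<^bsub>P\<^esub> g')"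
      using G_carrier by (simp add: P.a_ac)
    moreover have "g \<oplus>\<^bsub>P\<^esub> g' \<in> G"
      using h unfolding G_span by (intro lin_span.span_add)
    ultimately show ?thesis using h P.a_closed unfolding R_def by blast
  qed
  have R_smult: "c \<odot>\<^bsub>P\<^esub> x \<in> R" if x: "x \<in> R" for x c
  proof -
    obtain h g where h: "h \<in> I" "g \<in> G" and "x = h \<oplus>\<^bsub>P\<^esub> g"
      using x unfolding R_def by blast
    then have "c \<odot>\<^bsub>P\<^esub> x = c \<odot>\<^bsub>P\<^esub> h \<oplus>\<^bsub>P\<^esub> c \<odot>\<^bsub>P\<^esub> g"
      using G_carrier by (simp add: P.smult_r_distr)
    moreover have "c \<odot>\<^bsub>P\<^esub> g \<in> G"
      using h unfolding G_span by (intro lin_span.span_smult)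
    ultimately show ?thesis using h P.smult_mem_ideal unfolding R_def by blast
  qed
  have R_span: "x \<in> R" if T: "\<And>q. q \<in> T \<Longrightarrow> single q \<in> R" and x: "x \<in> lin_span P (single ` T)"
    for x T
    using x
  proof induction
    case span_zero
    show ?case by (rule I_R) simp
  qed (use T R_add R_smult in auto)
  define S where "S = {p \<in> paths Q. path_len p < m}"
  have "S \<subseteq> {e} \<times> {w. set w \<subseteq> arcs Q \<and> length w \<le> m}"
    by (auto simp: S_def mem_paths)
  then have fin: "finite S"
    using finite_lists_length_le[OF finite_arcs, of m] finite_subset by blast
  have trans: "trans ord" and antisym: "antisym ord"
    using ord by (auto simp: order_on_defs)
  \<comment> \<open>The induction measure is the number of short paths strictly below p. It is
    finite even if infinitely many long paths lie below p, and p itself may be long.\<close>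
  define below where "below p = {q \<in> S. (q, p) \<in> ord \<and> q \<noteq> p}" for p
  have single_R: "single p \<in> R" if "p \<in> paths Q" for p
    using that
  proof (induction "card (below p)" arbitrary: p rule: less_induct)
    case less
    show ?case
    proof (cases "p \<in> basis_paths Q I ord")
      case True
      then have "single p \<in> G"
        unfolding G_span by (intro lin_span.span_base) auto
      moreover have "single p = \<zero>\<^bsub>P\<^esub> \<oplus>\<^bsub>P\<^esub> single p"
        using less.prems by (simp add: single_carrier)
      ultimately show ?thesis
        unfolding R_def using \<open>\<zero>\<^bsub>P\<^esub> \<in> I\<close> by blast
    next
      case False
      then obtain h where h: "h \<in> I" "h p \<noteq> 0" "\<And>q. h q \<noteq> 0 \<Longrightarrow> (q, p) \<in> ord"
        using less.prems by (auto simp: basis_paths_def is_leading_path_def)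
      \<comment> \<open>Dividing h by its leading coefficient shows that p is congruent modulo I to
        r, a combination of paths strictly below p.\<close>
      define r where "r = (\<lambda>q. if q = p then 0 else - h q / h p)"
      have hP: "finite {q. h q \<noteq> 0}" "{q. h q \<noteq> 0} \<subseteq> paths Q"
        using h(1) P.a_subset by (auto simp: path_algebra_sel)
      have "single p = (1 / h p) \<odot>\<^bsub>P\<^esub> h \<oplus>\<^bsub>P\<^esub> r"
        using h(2) by (auto simp: path_algebra_sel single_def r_def)
      moreover have "(1 / h p) \<odot>\<^bsub>P\<^esub> h \<in> R"
        using h by (intro I_R P.smult_mem_ideal)
      moreover have "r \<in> R"
      proof (rule R_span)
        show "r \<in> lin_span P (single ` {q \<in> paths Q. (q, p) \<in> ord \<and> q \<noteq> p})"
          using h hP unfolding lin_span_single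
          by (auto simp: r_def elim!: rev_finite_subset)
        fix q assume q: "q \<in> {q \<in> paths Q. (q, p) \<in> ord \<and> q \<noteq> p}"
        show "single q \<in> R"
        proof (cases "q \<in> S")
          case True
          \<comment> \<open>Transitivity gives the comparison with p, and antisymmetry excludes p
            itself from \<open>below q\<close>.\<close>
          have "below q \<subseteq> below p"
            using q trans antisym unfolding below_def trans_def antisym_def by blast
          moreover have "q \<in> below p" "q \<notin> below q"
            using q True by (auto simp: below_def)
          ultimately have "below q \<subset> below p" by blast
          then have "card (below q) < card (below p)"
            using fin by (intro psubset_card_mono) (auto simp: below_def)
          then show ?thesis using less.hyps q by blast
        next
          case False
          then have "single q \<in> V m" using q by (intro single_V) (auto simp: S_def)
          then show ?thesis using m I_R by blast
        qed
      qed
      ultimately show ?thesis using R_add by simp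
    qed
  qed
  have "f \<in> lin_span P (single ` paths Q)"
    using f by (simp add: lin_span_single path_algebra_sel)
  then have "f \<in> R" using R_span[of "paths Q" f] single_R by blast
  then obtain h g where "h \<in> I" and g: "g \<in> G" and "f = h \<oplus>\<^bsub>P\<^esub> g"
    unfolding R_def by blast
  then have "f \<in> I +>\<^bsub>P\<^esub> g"
    by (auto simp: a_r_coset_def')
  then have "I +>\<^bsub>P\<^esub> f = I +>\<^bsub>P\<^esub> g"
    using P.a_repr_independence' G_carrier[OF g] by metis
  with g show ?thesis
    by (intro that) (auto simp: G_def)
qed

text \<open>This matches the finite sum by which \<open>ker_delta1\<close> prescribes the value on
  an arrow with the coset of the coefficient function.\<close>

lemma finsum_cls:
  assumes g: "g \<in> carrier P"
  shows "(\<Oplus>\<^bsub>A\<^esub>b\<in>{b. g b \<noteq> 0}. g b \<odot>\<^bsub>A\<^esub> cls Q I b) = I +>\<^bsub>P\<^esub> g"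
proof -
  have "(\<Oplus>\<^bsub>A\<^esub>b\<in>S. g b \<odot>\<^bsub>A\<^esub> cls Q I b) = I +>\<^bsub>P\<^esub> (\<lambda>p. if p \<in> S then g p else 0)"
    if "finite S" "S \<subseteq> paths Q" for S
    using that
  proof (induction S rule: finite_induct)
    case empty
    have "I +>\<^bsub>P\<^esub> \<zero>\<^bsub>P\<^esub> = I"
      by (rule P.a_rcos_const) simp
    then show ?case
      by (simp add: A_sel path_algebra_sel(2))
  next
    case (insert b S)
    let ?g = "\<lambda>S p. if p \<in> S then g p else 0"
    have gS: "?g S \<in> carrier P"
      using insert by (auto simp: path_algebra_sel elim!: rev_finite_subset split: if_splits)
    have b: "single b \<in> carrier P"
      using insert by (simp add: single_carrier)
    have "(\<Oplus>\<^bsub>A\<^esub>b\<in>insert b S. g b \<odot>\<^bsub>A\<^esub> cls Q I b) =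
        g b \<odot>\<^bsub>A\<^esub> cls Q I b \<oplus>\<^bsub>A\<^esub> (\<Oplus>\<^bsub>A\<^esub>b\<in>S. g b \<odot>\<^bsub>A\<^esub> cls Q I b)"
      using insert by (intro A.finsum_insert) (auto intro!: cls_carrier)
    also have "\<dots> = I +>\<^bsub>P\<^esub> (g b \<odot>\<^bsub>P\<^esub> single b \<oplus>\<^bsub>P\<^esub> ?g S)"
      using insert b gS by (simp add: cls_def A_smult A_add)
    also have "g b \<odot>\<^bsub>P\<^esub> single b \<oplus>\<^bsub>P\<^esub> ?g S = ?g (insert b S)"
      using insert by (auto simp: path_algebra_sel single_def)
    finally show ?case .
  qed
  moreover have "(\<lambda>p. if p \<in> {b. g b \<noteq> 0} then g p else 0) = g"
    by auto
  ultimately show ?thesis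
    using g unfolding path_algebra_sel by fastforce
qed

text \<open>The irreducible coefficients of d on all arrows together lie in
  \<open>ker_delta1\<close>, so every path b occurring in d(a) yields a pair (a, b) in some
  \<open>Sigma_set\<close>. \<open>Sigma0\<close> rules out the trivial path and
  \<open>Sigma1\<close> every arrow other than a; the rest has length at least 2.\<close>

lemma Der_arrow:
  assumes ord: "linear_order_on (paths Q) ord"
    and Sigma0: "Sigma_set Q I ord 0 = {}"
    and Sigma1: "\<And>a b. a \<in> arcs Q \<Longrightarrow> b \<in> arcs Q \<Longrightarrow> a \<noteq> b \<Longrightarrow>
      (a, arrow_path Q b) \<notin> Sigma_set Q I ord 1"
    and d: "d \<in> Der A" and a: "a \<in> arcs Q"
  obtains c r where "r \<in> F 2" "d (cls Q I (e, [a])) = c \<odot>\<^bsub>A\<^esub> cls Q I (e, [a]) \<oplus>\<^bsub>A\<^esub> r"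
proof -
  have "\<exists>g. g \<in> carrier P \<and> {p. g p \<noteq> 0} \<subseteq> basis_paths Q I ord \<and>
      d (cls Q I (e, [a])) = I +>\<^bsub>P\<^esub> g" if "a \<in> arcs Q" for a
  proof -
    have "d (cls Q I (e, [a])) \<in> carrier A"
      using d that by (simp add: cls_carrier mem_paths)
    then obtain f where f: "f \<in> carrier P" "d (cls Q I (e, [a])) = I +>\<^bsub>P\<^esub> f"
      by (auto simp: A_sel)
    show ?thesis
      using reduce[OF ord f(1)] f(2) by metis
  qed
  then obtain g where g: "g a \<in> carrier P" "{p. g a p \<noteq> 0} \<subseteq> basis_paths Q I ord"
      "d (cls Q I (e, [a])) = I +>\<^bsub>P\<^esub> g a" if "a \<in> arcs Q" for a
    by metis
  \<comment> \<open>All arrows enter at once because \<open>ker_delta1\<close> requires one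
    derivation to match x on every arrow. The value 0 off the arrows keeps the support finite and
    inside \<open>parallel_pairs\<close>.\<close>
  define x where "x = (\<lambda>(a, b). if a \<in> arcs Q then g a b else 0)"
  have x: "x (a, b) = g a b" if "a \<in> arcs Q" for a b
    using that by (simp add: x_def)
  have pairs: "{ab. x ab \<noteq> 0} \<subseteq> parallel_pairs Q I ord"
    using g(1,2) by (fastforce simp: x_def parallel_pairs_def is_path_iff ends path_algebra_sel
        mem_paths split: if_splits)
  have "x \<in> ker_delta1 Q I ord"
    unfolding ker_delta1_def
  proof (intro CollectI conjI bexI[of _ d] ballI)
    have "{ab. x ab \<noteq> 0} \<subseteq> (SIGMA a:arcs Q. {b. g a b \<noteq> 0})"
      by (auto simp: x_def split: if_splits)
    moreover have "finite (SIGMA a:arcs Q. {b. g a b \<noteq> 0})"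
      using g(1) by (auto simp: path_algebra_sel)
    ultimately show "finite {ab. x ab \<noteq> 0}"
      by (rule finite_subset)
    show "d (cls Q I (v, [])) = \<zero>\<^bsub>A\<^esub>" if "v \<in> verts Q" for v
      using that verts_Q d by (simp add: cls_Nil A.Der_one)
    show "d (cls Q I (arrow_path Q a)) =
        (\<Oplus>\<^bsub>A\<^esub>b\<in>{b. x (a, b) \<noteq> 0}. x (a, b) \<odot>\<^bsub>A\<^esub> cls Q I b)" if "a \<in> arcs Q" for a
      using that g by (simp add: x finsum_cls arrow_path_eq)
  qed (use pairs d in auto)
  then have Sigma: "(a, b) \<in> Sigma_set Q I ord (path_len b)" if "g a b \<noteq> 0" for b
  proof -
    have "x (a, b) \<noteq> 0"
      using that x[OF a] by simp
    with pairs \<open>x \<in> ker_delta1 Q I ord\<close> show ?thesis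
      unfolding Sigma_set_def by auto
  qed
  define r where "r = (\<lambda>p. if p = (e, [a]) then 0 else g a p)"
  have "r \<in> V 2"
    unfolding mem_arrow_ideal_pow
  proof (intro conjI allI impI)
    show "r \<in> carrier P"
      using g(1)[OF a] by (auto simp: r_def path_algebra_sel elim!: rev_finite_subset)
    fix p assume "r p \<noteq> 0"
    then have p: "p \<noteq> (e, [a])" "g a p \<noteq> 0" "p \<in> paths Q"
      using g(1)[OF a] by (auto simp: r_def path_algebra_sel split: if_splits)
    show "2 \<le> path_len p"
    proof (rule ccontr)
      assume "\<not> 2 \<le> path_len p"
      \<comment> \<open>\<open>remdups_adj.cases\<close> serves only to separate lists with no, one,
        or at least two entries.\<close>
      then consider "path_len p = 0" | b where "snd p = [b]"
        by (cases "snd p" rule: remdups_adj.cases) auto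
      then show False
      proof cases
        case 1
        then show ?thesis using Sigma[OF p(2)] Sigma0 by simp
      next
        case (2 b)
        then have "b \<in> arcs Q" "p = (e, [b])"
          using p(3) by (cases p; auto simp: mem_paths)+
        then show ?thesis
          using Sigma[OF p(2)] Sigma1[OF a, of b] p(1) by (auto simp: arrow_path_eq)
      qed
    qed
  qed
  moreover have "g a = g a (e, [a]) \<odot>\<^bsub>P\<^esub> single (e, [a]) \<oplus>\<^bsub>P\<^esub> r"
    by (auto simp: r_def path_algebra_sel single_def)
  then have "d (cls Q I (e, [a])) = g a (e, [a]) \<odot>\<^bsub>A\<^esub> cls Q I (e, [a]) \<oplus>\<^bsub>A\<^esub> (I +>\<^bsub>P\<^esub> r)"
    using g(3)[OF a] a V_carrier[OF \<open>r \<in> V 2\<close>]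
    by (simp add: cls_def A_smult A_add single_carrier mem_paths)
  ultimately show ?thesis
    by (intro that) (auto simp: F_def)
qed

lemma lie_solvable_HH1:
  assumes ord: "linear_order_on (paths Q) ord"
    and Sigma0: "Sigma_set Q I ord 0 = {}"
    and Sigma1: "\<And>a b. a \<in> arcs Q \<Longrightarrow> b \<in> arcs Q \<Longrightarrow> a \<noteq> b \<Longrightarrow>
      (a, arrow_path Q b) \<notin> Sigma_set Q I ord 1"
  shows "lie_solvable (HH1 A)"
proof -
  note Der_arrow = Der_arrow[OF ord Sigma0 Sigma1]
  have arrow: "cls Q I (e, [a]) \<in> F 1" if "a \<in> arcs Q" for a
    using cls_F[of "(e, [a])"] that by (simp add: mem_paths)
  have Der: "d x \<in> F i" if d: "d \<in> Der A" and x: "x \<in> F i" for d x i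
  proof -
    have "d (cls Q I (e, [a])) \<in> F (Suc 0)" if "a \<in> arcs Q" for a
    proof -
      obtain c r where "r \<in> F 2" "d (cls Q I (e, [a])) = c \<odot>\<^bsub>A\<^esub> cls Q I (e, [a]) \<oplus>\<^bsub>A\<^esub> r"
        using Der_arrow[OF _ _ _ d \<open>a \<in> arcs Q\<close>] by blast
      then show ?thesis
        using arrow[OF that] F_anti[of 1 2] by (auto intro!: F_add F_smult)
    qed
    from Der_shift[OF d this x] show ?thesis by simp
  qed
  have bracket: "(d \<otimes>\<^bsub>Der_lie A\<^esub> d') x \<in> F (Suc i)"
    if d: "d \<in> Der A" "d' \<in> Der A" and x: "x \<in> F i" for d d' x i
  proof -
    \<comment> \<open>The instance k = 1 of \<open>Der_shift\<close> needs the arrows to land in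
      \<open>F (Suc 1)\<close>, that is in J^2.\<close>
    have "(d \<otimes>\<^bsub>Der_lie A\<^esub> d') (cls Q I (e, [a])) \<in> F (Suc 1)" if a: "a \<in> arcs Q" for a
    proof -
      let ?a = "cls Q I (e, [a])"
      obtain c r where r: "r \<in> F 2" "d ?a = c \<odot>\<^bsub>A\<^esub> ?a \<oplus>\<^bsub>A\<^esub> r"
        using Der_arrow[OF _ _ _ d(1) a] by blast
      obtain c' r' where r': "r' \<in> F 2" "d' ?a = c' \<odot>\<^bsub>A\<^esub> ?a \<oplus>\<^bsub>A\<^esub> r'"
        using Der_arrow[OF _ _ _ d(2) a] by blast
      note car = F_carrier[OF arrow[OF a]] F_carrier[OF r(1)] F_carrier[OF r'(1)]
      \<comment> \<open>What remains of the commutator once the multiples of the arrow cancel. The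
        difference is written with the scalar -1, so that \<open>F_add\<close> and
        \<open>F_smult\<close> apply; \<open>d r'\<close> and \<open>d' r\<close> stay in
        \<open>F 2\<close> by \<open>Der\<close>.\<close>
      let ?s = "(c' \<odot>\<^bsub>A\<^esub> r \<oplus>\<^bsub>A\<^esub> d r') \<oplus>\<^bsub>A\<^esub> (-1) \<odot>\<^bsub>A\<^esub> (c \<odot>\<^bsub>A\<^esub> r' \<oplus>\<^bsub>A\<^esub> d' r)"
      \<comment> \<open>Both compositions multiply the arrow by the same scalar, since c and c'
        commute in the field; they differ only in their parts from \<open>F 2\<close>.\<close>
      have dd: "d (d' ?a) = (c' * c) \<odot>\<^bsub>A\<^esub> ?a \<oplus>\<^bsub>A\<^esub> (c' \<odot>\<^bsub>A\<^esub> r \<oplus>\<^bsub>A\<^esub> d r')"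
        using car d by (simp add: r r' A.Der_add A.Der_smult A.smult_r_distr A.smult_assoc A.a_assoc)
      have dd': "d' (d ?a) = (c' * c) \<odot>\<^bsub>A\<^esub> ?a \<oplus>\<^bsub>A\<^esub> (c \<odot>\<^bsub>A\<^esub> r' \<oplus>\<^bsub>A\<^esub> d' r)"
        using car d by (simp add: r r' A.Der_add A.Der_smult A.smult_r_distr A.smult_assoc A.a_assoc
            mult.commute)
      have "(p \<oplus>\<^bsub>A\<^esub> q) \<ominus>\<^bsub>A\<^esub> (p \<oplus>\<^bsub>A\<^esub> q') = q \<oplus>\<^bsub>A\<^esub> (-1) \<odot>\<^bsub>A\<^esub> q'"
        if "p \<in> carrier A" "q \<in> carrier A" "q' \<in> carrier A" for p q q'
        using that A.smult_neg_one by algebra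
      then have "(d \<otimes>\<^bsub>Der_lie A\<^esub> d') ?a = ?s"
        using car d by (simp add: A.Der_lie_mult dd dd')
      moreover have "?s \<in> F 2"
        using r(1) r'(1) Der d by (intro F_add F_smult)
      ultimately show ?thesis by (simp add: numeral_2_eq_2)
    qed
    from Der_shift[OF A.mult_mem_Der[OF d] this x] show ?thesis by simp
  qed
  obtain m where "F m \<subseteq> {\<zero>\<^bsub>A\<^esub>}" by (rule F_nilpotent)
  then show ?thesis
    using Der bracket
    by (intro A.lie_solvable_HH1_filtration[of F m] F_0 F_anti F_zero F_add F_smult)
qed

end

theorem proposition3p5:
  fixes Q :: "('v, 'a) pre_digraph"
    and I :: "(('v, 'a) path \<Rightarrow> 'k::alg_closed_field) set"
    and ord :: "('v, 'a) path rel"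
    and n :: nat
    and \<alpha> :: "nat \<Rightarrow> 'a"
  assumes quiver: "fin_digraph Q"
    and adm: "admissible_ideal Q I"
    and graded: "graded_ideal Q I"
    and loc: "card (verts Q) = 1"
    and findim: "fin_dim (quiver_algebra Q I)"
    and ord: "linear_order_on (paths Q) ord"
    and Sigma0: "Sigma_set Q I ord 0 = {}"
    and arrows: "bij_betw \<alpha> {1..n} (arcs Q)"
    and Sigma1: "\<And>i j. i \<in> {1..n} \<Longrightarrow> j \<in> {1..n} \<Longrightarrow> i \<noteq> j \<Longrightarrow>
                   (\<alpha> i, arrow_path Q (\<alpha> j)) \<notin> Sigma_set Q I ord 1"
  shows "lie_solvable (HH1 (quiver_algebra Q I))"
proof -
  obtain e where "verts Q = {e}"
    using loc by (auto simp: card_1_singleton_iff)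
  then interpret local_quiver_algebra Q e I
    using quiver adm by (intro local_quiver_algebra.intro local_quiver_algebra_axioms.intro)
  show ?thesis
  proof (rule lie_solvable_HH1[OF ord Sigma0])
    fix a b assume ab: "a \<in> arcs Q" "b \<in> arcs Q" "a \<noteq> b"
    then obtain i j where "i \<in> {1..n}" "j \<in> {1..n}" "a = \<alpha> i" "b = \<alpha> j"
      using bij_betw_imp_surj_on[OF arrows] by blast
    then show "(a, arrow_path Q b) \<notin> Sigma_set Q I ord 1"
      using Sigma1 ab by blast
  qed
qed

end
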